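(* Let $K\subset\mathbb{R}^2$ be a convex quadrilateral, and let $W_K$ and the degrees of freedom $T_K=\{\tau_1,\dots,\tau_{12}\}$ be as defined in the context. Then: (1) The finite element $(K,W_K,T_K)$ is well-defined, i.e. $\dim W_K=12$ and, if $w\in W_K$ satisfies $\tau_j(w)=0$ for $j=1,\dots,12$, then $w=0$. (2) For all $w\in W_K$ and $i=1,2,3,4$, $$\frac{1}{|E_i|}\int_{E_i}w\,\mathrm{d}s=\frac{1}{2}\left(w(V_i)+w(V_{i+1})\right)-\frac{|E_i|}{12}\left(\frac{\partial w}{\partial \boldsymbol{t}_i}(V_{i+1})-\frac{\partial w}{\partial \boldsymbol{t}_i}(V_{i})\right).$$ (3) $P_2(K)\subset W_K$.
   Context: $P_k(K)$ denotes the polynomials of degree at most $k$ on $K$. Geometry: $K$ has vertices $V_1,V_2,V_3,V_4$ in counterclockwise order, indices $i$ are taken modulo 4, $E_i=V_iV_{i+1}$ is the $i$-th edge with length $|E_i|$ and midpoint $M_i$; $\boldsymbol{n}_i$ is a unit normal of $E_i$ and $\boldsymbol{t}_i$ is the unit tangent of $E_i$ pointing from $V_i$ to $V_{i+1}$. Let $l_i$, $m_{13}$, $m_{24}$, $l_{13}$, $l_{24}$ be the affine functions of $(x,y)$ vanishing respectively on the lines containing $E_i$, $M_1M_3$, $M_2M_4$, $V_1V_3$, $V_2V_4$, uniquely normalized by $l_1(M_3)=l_2(M_4)=l_3(M_1)=l_4(M_2)=m_{13}(M_2)=m_{24}(M_3)=l_{13}(V_4)=l_{24}(V_3)=1$.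 Let $\boldsymbol{A}=\frac14\left(V_3-V_4-V_1+V_2,\;V_3+V_4-V_1-V_2\right)$ (a $2\times2$ matrix given by its columns), $\boldsymbol{d}=\frac14(V_3-V_4+V_1-V_2)$, and $(s_1,s_2)^T=\boldsymbol{A}^{-1}\boldsymbol{d}$. Auxiliary space: $W_K^-=P_3(K)\oplus\mathrm{span}\{\phi_1,\phi_2\}$ with $$\phi_1=(s_2-1)(s_2+1)l_1l_3m_{13}m_{24}-s_1s_2l_1l_3m_{24}^2+s_1l_1l_3m_{24}^2m_{13},$$ $$\phi_2=(s_1-1)(s_1+1)l_2l_4m_{13}m_{24}-s_1s_2l_2l_4m_{13}^2+s_2l_2l_4m_{13}^2m_{24}.$$ Bubble space: $W_K^b=\mathrm{span}\{b_0,b_0x,b_0y,b_0l_{13}l_{24}\}$, $b_0=l_1l_2l_3l_4$. Shape function space: $$W_K=\left\{w\in W_K^-\oplus W_K^b:\ \frac{1}{|E_{i}|}\int_{E_{i}}\frac{\partial w}{\partial \boldsymbol{n}_{i}}\,\mathrm{d}s=\frac{1}{2}\left(\frac{\partial w}{\partial \boldsymbol{n}_{i}}(V_i)+\frac{\partial w}{\partial \boldsymbol{n}_{i}}(V_{i+1})\right),\ i=1,2,3,4\right\}.$$ Degrees of freedom: $\tau_j(w)=w(V_j)$, $(\tau_{j+4}(w),\tau_{j+8}(w))^T=\nabla w(V_j)$, $j=1,\dots,4$. *)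

theory Defs
  imports "HOL-Analysis.Analysis" "HOL-Library.Function_Algebras"
begin

text \<open>
  The functions in question are polynomials, represented as functions on the whole plane.
  Since a convex quadrilateral has nonempty interior, such a function is determined by its
  restriction to the quadrilateral. Function addition is pointwise addition (and zero the
  zero function), so the only missing ingredient of the real vector space of functions is
  scalar multiplication.
\<close>

definition scale_fun :: "real \<Rightarrow> (real^2 \<Rightarrow> real) \<Rightarrow> real^2 \<Rightarrow> real" where
  "scale_fun c f = (\<lambda>p. c * f p)"

interpretation funs: vector_space scale_fun
  by unfold_locales (auto simp: scale_fun_def fun_eq_iff algebra_simps)

definition poly_space :: "nat \<Rightarrow> (real^2 \<Rightarrow> real) set" where
  "poly_space k = funs.span {(\<lambda>p. (p$1)^a * (p$2)^b) |a b. a + b \<le> k}"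


subsection \<open>Geometry\<close>

definition cross2 :: "real^2 \<Rightarrow> real^2 \<Rightarrow> real" where
  "cross2 u v = u$1 * v$2 - u$2 * v$1"

text \<open>
  The four vertices are indexed by the type \<^typ>\<open>4\<close> of integers modulo 4, in which
  \<open>4 = 0\<close>; index arithmetic is therefore cyclic. Listing the vertices counterclockwise means
  that the two vertices not on an edge lie strictly to the left of that edge; in particular
  no three vertices are collinear.
\<close>

definition convex_quadrilateral :: "(real^2) set \<Rightarrow> (4 \<Rightarrow> real^2) \<Rightarrow> bool" where
  "convex_quadrilateral K V \<longleftrightarrow>
     K = convex hull (range V) \<and>
     (\<forall>i j. j \<noteq> i \<and> j \<noteq> i + 1 \<longrightarrow> 0 < cross2 (V (i + 1) - V i) (V j - V i))"

definition edge_length :: "(4 \<Rightarrow> real^2) \<Rightarrow> 4 \<Rightarrow> real" where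
  "edge_length V i = dist (V i) (V (i + 1))"

definition edge_mid :: "(4 \<Rightarrow> real^2) \<Rightarrow> 4 \<Rightarrow> real^2" where
  "edge_mid V i = midpoint (V i) (V (i + 1))"

definition edge_tangent :: "(4 \<Rightarrow> real^2) \<Rightarrow> 4 \<Rightarrow> real^2" where
  "edge_tangent V i = (V (i + 1) - V i) /\<^sub>R edge_length V i"

definition edge_unit_normal :: "(4 \<Rightarrow> real^2) \<Rightarrow> 4 \<Rightarrow> real^2 \<Rightarrow> bool" where
  "edge_unit_normal V i n \<longleftrightarrow> norm n = 1 \<and> n \<bullet> (V (i + 1) - V i) = 0"

text \<open>The line integral over an edge, computed in its arc length parametrisation.\<close>

definition edge_integral :: "(4 \<Rightarrow> real^2) \<Rightarrow> 4 \<Rightarrow> (real^2 \<Rightarrow> real) \<Rightarrow> real" where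
  "edge_integral V i f =
     integral {0..edge_length V i} (\<lambda>s. f (V i + s *\<^sub>R edge_tangent V i))"

definition dir_deriv :: "real^2 \<Rightarrow> (real^2 \<Rightarrow> real) \<Rightarrow> real^2 \<Rightarrow> real" where
  "dir_deriv v w p = frechet_derivative w (at p) v"

definition gradient :: "(real^2 \<Rightarrow> real) \<Rightarrow> real^2 \<Rightarrow> real^2" where
  "gradient w p = (\<chi> k. dir_deriv (axis k 1) w p)"


subsection \<open>Normalized affine functions\<close>

text \<open>
  The affine function vanishing on the line through \<open>a\<close> and \<open>b\<close> with value 1 at \<open>c\<close>;
  lemma \<open>ex1_line_function\<close> justifies the definite description.
\<close>

definition is_line_function :: "real^2 \<Rightarrow> real^2 \<Rightarrow> real^2 \<Rightarrow> (real^2 \<Rightarrow> real) \<Rightarrow> bool" where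
  "is_line_function a b c f \<longleftrightarrow>
     (\<exists>u k. f = (\<lambda>p. u \<bullet> p + k)) \<and> (\<forall>p \<in> affine hull {a, b}. f p = 0) \<and> f c = 1"

definition line_function :: "real^2 \<Rightarrow> real^2 \<Rightarrow> real^2 \<Rightarrow> real^2 \<Rightarrow> real" where
  "line_function a b c = (THE f. is_line_function a b c f)"

lemma is_line_function_cross2:
  assumes "cross2 (b - a) (c - a) \<noteq> 0"
  shows "is_line_function a b c (\<lambda>p. cross2 (b - a) (p - a) / cross2 (b - a) (c - a))"
    (is "is_line_function a b c (\<lambda>p. _ / ?D)")
proof -
  let ?u = "(vector [- (b - a)$2 / ?D, (b - a)$1 / ?D]) :: real^2"
  have "(\<lambda>p. cross2 (b - a) (p - a) / ?D) = (\<lambda>p. ?u \<bullet> p + (- (?u \<bullet> a)))"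
    by (simp add: fun_eq_iff inner_vec_def sum_2 cross2_def diff_divide_distrib add_divide_distrib algebra_simps)
  moreover have "cross2 (b - a) (p - a) / ?D = 0" if p: "p \<in> affine hull {a, b}" for p
  proof -
    obtain s t :: real where st: "p = s *\<^sub>R a + t *\<^sub>R b" "s + t = 1"
      using p unfolding affine_hull_2 by blast
    have "s = 1 - t" using st(2) by simp
    with st(1) have "p - a = t *\<^sub>R (b - a)"
      by (simp add: scaleR_diff_left scaleR_diff_right)
    then show ?thesis by (simp add: cross2_def)
  qed
  ultimately show ?thesis
    unfolding is_line_function_def by (intro conjI exI ballI) (assumption | simp add: assms)+
qed

lemma ex1_line_function:
  assumes "cross2 (b - a) (c - a) \<noteq> 0"
  shows "\<exists>!f. is_line_function a b c f"
proof (rule ex_ex1I)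
  show "\<exists>f. is_line_function a b c f"
    using is_line_function_cross2[OF assms] by blast
next
  fix f g
  assume "is_line_function a b c f" "is_line_function a b c g"
  then obtain u k v m where f: "f = (\<lambda>p. u \<bullet> p + k)" and g: "g = (\<lambda>p. v \<bullet> p + m)"
    and eqs: "f a = 0" "f b = 0" "f c = 1" "g a = 0" "g b = 0" "g c = 1"
    unfolding is_line_function_def by (metis hull_inc insert_iff)
  define z where "z = u - v"
  define B where "B = b - a"
  define C where "C = c - a"
  have "z \<bullet> B = 0" "z \<bullet> C = 0"
    using eqs by (auto simp: f g z_def B_def C_def inner_diff_left inner_diff_right)
  then have zB: "z$1 * B$1 + z$2 * B$2 = 0" and zC: "z$1 * C$1 + z$2 * C$2 = 0"
    by (auto simp: inner_vec_def sum_2)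
  have D: "B$1 * C$2 - B$2 * C$1 \<noteq> 0"
    using assms by (simp add: cross2_def B_def C_def)
  have "z$1 * (B$1 * C$2 - B$2 * C$1) = 0" "z$2 * (B$1 * C$2 - B$2 * C$1) = 0"
    using zB zC by algebra+
  then have "z = 0" using D by (simp add: vec_eq_iff forall_2)
  then have "u = v" by (simp add: z_def)
  moreover from this have "k = m" using eqs by (simp add: f g)
  ultimately show "f = g" by (simp add: f g)
qed

lemma line_function_eq:
  assumes "cross2 (b - a) (c - a) \<noteq> 0"
  shows "line_function a b c p = cross2 (b - a) (p - a) / cross2 (b - a) (c - a)"
proof -
  have "line_function a b c = (\<lambda>p. cross2 (b - a) (p - a) / cross2 (b - a) (c - a))"
    unfolding line_function_def
    by (rule the1_equality, rule ex1_line_function[OF assms], rule is_line_function_cross2[OF assms])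
  then show ?thesis by simp
qed

definition l_edge :: "(4 \<Rightarrow> real^2) \<Rightarrow> 4 \<Rightarrow> real^2 \<Rightarrow> real" where
  "l_edge V i = line_function (V i) (V (i + 1)) (edge_mid V (i + 2))"

definition m13 :: "(4 \<Rightarrow> real^2) \<Rightarrow> real^2 \<Rightarrow> real" where
  "m13 V = line_function (edge_mid V 1) (edge_mid V 3) (edge_mid V 2)"

definition m24 :: "(4 \<Rightarrow> real^2) \<Rightarrow> real^2 \<Rightarrow> real" where
  "m24 V = line_function (edge_mid V 2) (edge_mid V 4) (edge_mid V 3)"

definition l13 :: "(4 \<Rightarrow> real^2) \<Rightarrow> real^2 \<Rightarrow> real" where
  "l13 V = line_function (V 1) (V 3) (V 4)"

definition l24 :: "(4 \<Rightarrow> real^2) \<Rightarrow> real^2 \<Rightarrow> real" where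
  "l24 V = line_function (V 2) (V 4) (V 3)"


subsection \<open>Shape function space and degrees of freedom\<close>

definition A_mat :: "(4 \<Rightarrow> real^2) \<Rightarrow> real^2^2" where
  "A_mat V = (1/4) *\<^sub>R transpose (vector [V 3 - V 4 - V 1 + V 2, V 3 + V 4 - V 1 - V 2])"

definition d_vec :: "(4 \<Rightarrow> real^2) \<Rightarrow> real^2" where
  "d_vec V = (1/4) *\<^sub>R (V 3 - V 4 + V 1 - V 2)"

definition s_vec :: "(4 \<Rightarrow> real^2) \<Rightarrow> real^2" where
  "s_vec V = matrix_inv (A_mat V) *v d_vec V"

definition phi1 :: "(4 \<Rightarrow> real^2) \<Rightarrow> real^2 \<Rightarrow> real" where
  "phi1 V = (\<lambda>p. let s1 = s_vec V $ 1; s2 = s_vec V $ 2 in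
     (s2 - 1) * (s2 + 1) * l_edge V 1 p * l_edge V 3 p * m13 V p * m24 V p
     - s1 * s2 * l_edge V 1 p * l_edge V 3 p * (m24 V p)\<^sup>2
     + s1 * l_edge V 1 p * l_edge V 3 p * (m24 V p)\<^sup>2 * m13 V p)"

definition phi2 :: "(4 \<Rightarrow> real^2) \<Rightarrow> real^2 \<Rightarrow> real" where
  "phi2 V = (\<lambda>p. let s1 = s_vec V $ 1; s2 = s_vec V $ 2 in
     (s1 - 1) * (s1 + 1) * l_edge V 2 p * l_edge V 4 p * m13 V p * m24 V p
     - s1 * s2 * l_edge V 2 p * l_edge V 4 p * (m13 V p)\<^sup>2
     + s2 * l_edge V 2 p * l_edge V 4 p * (m13 V p)\<^sup>2 * m24 V p)"

definition b0 :: "(4 \<Rightarrow> real^2) \<Rightarrow> real^2 \<Rightarrow> real" where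
  "b0 V = (\<lambda>p. l_edge V 1 p * l_edge V 2 p * l_edge V 3 p * l_edge V 4 p)"

definition W_minus :: "(4 \<Rightarrow> real^2) \<Rightarrow> (real^2 \<Rightarrow> real) set" where
  "W_minus V = {u + v |u v. u \<in> poly_space 3 \<and> v \<in> funs.span {phi1 V, phi2 V}}"

definition W_bubble :: "(4 \<Rightarrow> real^2) \<Rightarrow> (real^2 \<Rightarrow> real) set" where
  "W_bubble V = funs.span
     {b0 V, \<lambda>p. b0 V p * p$1, \<lambda>p. b0 V p * p$2, \<lambda>p. b0 V p * l13 V p * l24 V p}"

text \<open>
  The argument \<open>n\<close> is the chosen family of unit normals; the space does not depend on their
  orientation.
\<close>

definition W_space :: "(4 \<Rightarrow> real^2) \<Rightarrow> (4 \<Rightarrow> real^2) \<Rightarrow> (real^2 \<Rightarrow> real) set" where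
  "W_space V n = {w \<in> {u + v |u v. u \<in> W_minus V \<and> v \<in> W_bubble V}.
     \<forall>i. 1 / edge_length V i * edge_integral V i (dir_deriv (n i) w)
        = 1/2 * (dir_deriv (n i) w (V i) + dir_deriv (n i) w (V (i + 1)))}"

text \<open>The degrees of freedom \<open>tau V j\<close>, meaningful for \<open>j = 1, \<dots>, 12\<close>.\<close>

definition tau :: "(4 \<Rightarrow> real^2) \<Rightarrow> nat \<Rightarrow> (real^2 \<Rightarrow> real) \<Rightarrow> real" where
  "tau V j w =
     (if j \<le> 4 then w (V (of_nat j))
      else if j \<le> 8 then gradient w (V (of_nat (j - 4))) $ 1
      else gradient w (V (of_nat (j - 8))) $ 2)"

end

(*
Restricted to an edge, parametrised by t in [-1,1], every function of the 16-dimensional ambient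
space is a combination of 1, t, t^2, t^3, t^5: the bubbles vanish there, and the coefficients of
phi_1, phi_2 are chosen such that the t^4 terms cancel. The corrected trapezoidal rule is exact for
these powers, which gives (2).

Unisolvence: if all degrees of freedom of w vanish, then w is a multiple of t (1 - t^2)^2 on each
edge, so the cubic part p of w vanishes at all vertices and edge midpoints. By a Cayley-Bacharach
type elimination p = a l_1 l_3 m_24 + b l_2 l_4 m_13, and comparing double roots on opposite edges
gives a = b = 0 and kills the coefficients of phi_1, phi_2. What remains is w = b_0 q, for which the
normal derivative constraints say that weighted means of q on the four edges vanish. Since
l_13 l_24 changes sign from each edge to the next, this would force the affine part of q to
alternate in sign around the quadrilateral, which contradicts the crossing of the diagonals unless
q = 0. So the 12 degrees of freedom and the 4 constraints together are injective, hence bijective,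
on 16 coefficients, and the kernel of the constraints has dimension 12.
*)

theory Submission
  imports Defs
begin

subsection \<open>Polynomials\<close>

lemma subspace_funsI:
  assumes "P (\<lambda>p. 0)" "\<And>f g. P f \<Longrightarrow> P g \<Longrightarrow> P (\<lambda>p. f p + g p)" "\<And>c f. P f \<Longrightarrow> P (\<lambda>p. c * f p)"
  shows "funs.subspace {f. P f}"
  using assms unfolding funs.subspace_def scale_fun_def plus_fun_def zero_fun_def by auto

text \<open>Span induction with the vector space operations written pointwise, the shape in which
  derivatives, integrals and restrictions to edges are computed.\<close>

lemma span_funs_induct [consumes 1, case_names zero add scale base]:
  assumes "f \<in> funs.span S"
    and "P (\<lambda>p. 0)" "\<And>f g. P f \<Longrightarrow> P g \<Longrightarrow> P (\<lambda>p. f p + g p)" "\<And>c f. P f \<Longrightarrow> P (\<lambda>p. c * f p)"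
    and "\<And>f. f \<in> S \<Longrightarrow> P f"
  shows "P f"
  using funs.span_induct[OF assms(1) subspace_funsI[of P, OF assms(2-4)]] assms(5) by blast

lemma poly_space_monomial: "a + b \<le> k \<Longrightarrow> (\<lambda>p. (p$1)^a * (p$2)^b) \<in> poly_space k"
  unfolding poly_space_def 
  by (rule funs.span_base, rule CollectI, rule exI[of _ a], rule exI[of _ b]) simp

lemma poly_space_add: "f \<in> poly_space k \<Longrightarrow> g \<in> poly_space k \<Longrightarrow> (\<lambda>p. f p + g p) \<in> poly_space k"
  unfolding poly_space_def using funs.span_add[of f _ g] by (simp add: plus_fun_def)

lemma poly_space_scale: "f \<in> poly_space k \<Longrightarrow> (\<lambda>p. c * f p) \<in> poly_space k"
  unfolding poly_space_def using funs.span_scale[of f _ c] by (simp add: scale_fun_def)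

lemma poly_space_const: "(\<lambda>p. c) \<in> poly_space k"
  using poly_space_scale[OF poly_space_monomial[of 0 0 k], of c] by simp

lemma poly_space_mono:
  assumes "j \<le> k"
  shows "poly_space j \<subseteq> poly_space k"
proof -
  have "(\<lambda>p. (p$1)^a * (p$2)^b) \<in> {(\<lambda>p::real^2. (p$1)^a * (p$2)^b) |a b. a + b \<le> k}"
    if "a + b \<le> j" for a b
    by (rule CollectI, rule exI[of _ a], rule exI[of _ b]) (use that assms in simp)
  then show ?thesis
    unfolding poly_space_def by (intro funs.span_mono) auto
qed

lemma poly_space_mult:
  assumes "f \<in> poly_space j" "g \<in> poly_space k"
  shows "(\<lambda>p. f p * g p) \<in> poly_space (j + k)"
  using assms(1)[unfolded poly_space_def]
proof (induction rule: span_funs_induct)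
  case (base f)
  then obtain a b where f: "f = (\<lambda>p. (p$1)^a * (p$2)^b)" "a + b \<le> j" by auto
  show ?case using assms(2)[unfolded poly_space_def]
  proof (induction rule: span_funs_induct)
    case (base g)
    then obtain c d where g: "g = (\<lambda>p. (p$1)^c * (p$2)^d)" "c + d \<le> k" by auto
    have "(\<lambda>p. f p * g p) = (\<lambda>p. (p$1)^(a+c) * (p$2)^(b+d))"
      by (simp add: f g power_add fun_eq_iff)
    then show ?case using poly_space_monomial[of "a+c" "b+d" "j+k"] f g by simp
  next
    case (scale c f')
    then show ?case using poly_space_scale[OF scale, of c] by (simp add: algebra_simps)
  next
    case (add g g')
    then show ?case using poly_space_add[OF add] by (simp add: distrib_left)
  qed (simp add: poly_space_const)
next
  case (scale c f')
  then show ?case using poly_space_scale[OF scale, of c] by (simp add: algebra_simps)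
next
  case (add f f')
  then show ?case using poly_space_add[OF add] by (simp add: distrib_right)
qed (simp add: poly_space_const)

lemma poly_space_power: "f \<in> poly_space 1 \<Longrightarrow> (\<lambda>p. f p ^ a) \<in> poly_space a"
proof (induction a)
  case (Suc a)
  then show ?case using poly_space_mult[of f 1 "\<lambda>p. f p ^ a" a] by simp
qed (simp add: poly_space_const)

text \<open>Pullback along an affine map does not raise the degree. It serves both the restriction
  to a line and the passage to reference coordinates.\<close>

lemma poly_space_compose:
  assumes "f \<in> poly_space k" "(\<lambda>z. F z $ 1) \<in> poly_space 1" "(\<lambda>z. F z $ 2) \<in> poly_space 1"
  shows "(\<lambda>z. f (F z)) \<in> poly_space k"
  using assms(1)[unfolded poly_space_def]
proof (induction rule: span_funs_induct)
  case (base f)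
  then obtain a b where f: "f = (\<lambda>p. (p$1)^a * (p$2)^b)" "a + b \<le> k" by auto
  have "(\<lambda>z. (F z$1)^a * (F z$2)^b) \<in> poly_space (a + b)"
    by (intro poly_space_mult poly_space_power assms)
  then show ?case using poly_space_mono[OF f(2)] by (auto simp: f(1))
next
  case (add f f')
  show ?case by (rule poly_space_add[OF add])
next
  case (scale c f)
  show ?case by (rule poly_space_scale[OF scale])
qed (simp add: poly_space_const)

section \<open>Normal form of cubics in two variables\<close>

definition cubic :: "real \<Rightarrow> real \<Rightarrow> real \<Rightarrow> real \<Rightarrow> real \<Rightarrow> real \<Rightarrow> real \<Rightarrow> real \<Rightarrow> real \<Rightarrow> real \<Rightarrow> real \<Rightarrow> real \<Rightarrow> real" where
  "cubic c00 c10 c01 c20 c11 c02 c30 c21 c12 c03 x y =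
     c00 + c10 * x + c01 * y + c20 * x^2 + c11 * x * y + c02 * y^2
     + c30 * x^3 + c21 * x^2 * y + c12 * x * y^2 + c03 * y^3"

lemma cubic_in_poly_space:
  "(\<lambda>p. cubic c00 c10 c01 c20 c11 c02 c30 c21 c12 c03 (p$1) (p$2)) \<in> poly_space 3"
proof -
  have m: "(\<lambda>p. c * (p$1)^a * (p$2)^b) \<in> poly_space 3" if "a + b \<le> 3" for c a b
    using poly_space_scale[OF poly_space_monomial[OF that], of c] by (simp add: mult.assoc)
  show ?thesis unfolding cubic_def
    using m[of 0 0 c00] m[of 1 0 c10] m[of 0 1 c01] m[of 2 0 c20] m[of 1 1 c11]
      m[of 0 2 c02] m[of 3 0 c30] m[of 2 1 c21] m[of 1 2 c12] m[of 0 3 c03]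
    by (intro poly_space_add) simp_all
qed

lemma monomial_degree_le_3:
  assumes "a + b \<le> (3::nat)"
  shows "(a,b) \<in> {(0,0),(1,0),(0,1),(2,0),(1,1),(0,2),(3,0),(2,1),(1,2),(0,3)}"
  using assms by (simp, presburger)

lemma poly_space_3_cubic:
  assumes "f \<in> poly_space 3"
  shows "\<exists>c00 c10 c01 c20 c11 c02 c30 c21 c12 c03.
           f = (\<lambda>p. cubic c00 c10 c01 c20 c11 c02 c30 c21 c12 c03 (p$1) (p$2))"
  using assms unfolding poly_space_def
proof (induction rule: span_funs_induct)
  case zero
  have "(\<lambda>p. 0) = (\<lambda>p::real^2. cubic 0 0 0 0 0 0 0 0 0 0 (p$1) (p$2))" by (simp add: cubic_def)
  then show ?case by blast
next
  case (add f g)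
  then obtain a00 a10 a01 a20 a11 a02 a30 a21 a12 a03 b00 b10 b01 b20 b11 b02 b30 b21 b12 b03
    where "f = (\<lambda>p. cubic a00 a10 a01 a20 a11 a02 a30 a21 a12 a03 (p$1) (p$2))"
          "g = (\<lambda>p. cubic b00 b10 b01 b20 b11 b02 b30 b21 b12 b03 (p$1) (p$2))" by blast
  then have "(\<lambda>p. f p + g p) = (\<lambda>p. cubic (a00+b00) (a10+b10) (a01+b01) (a20+b20) (a11+b11)
       (a02+b02) (a30+b30) (a21+b21) (a12+b12) (a03+b03) (p$1) (p$2))"
    by (simp add: cubic_def fun_eq_iff algebra_simps)
  then show ?case by blast
next
  case (scale c f)
  then obtain a00 a10 a01 a20 a11 a02 a30 a21 a12 a03
    where "f = (\<lambda>p. cubic a00 a10 a01 a20 a11 a02 a30 a21 a12 a03 (p$1) (p$2))" by blast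
  then have "(\<lambda>p. c * f p) = (\<lambda>p. cubic (c*a00) (c*a10) (c*a01) (c*a20) (c*a11)
       (c*a02) (c*a30) (c*a21) (c*a12) (c*a03) (p$1) (p$2))"
    by (simp add: cubic_def fun_eq_iff algebra_simps)
  then show ?case by blast
next
  case (base f)
  then obtain a b where f: "f = (\<lambda>p. (p$1)^a * (p$2)^b)" "a + b \<le> 3" by auto
  \<comment> \<open>Kronecker delta: a monomial is the cubic with a single coefficient 1.\<close>
  define d where "d i j = (if (a, b) = (i, j) then 1 else (0::real))" for i j
  have "f = (\<lambda>p. cubic (d 0 0) (d 1 0) (d 0 1) (d 2 0) (d 1 1) (d 0 2) (d 3 0) (d 2 1) (d 1 2) (d 0 3) (p$1) (p$2))"
    using monomial_degree_le_3[OF f(2)] unfolding f(1) by (auto simp: d_def cubic_def)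
  then show ?case by blast
qed

text \<open>Ten evaluation points suffice: four on each axis, sharing the origin, isolate the pure
  powers, and three of the points with coordinates 1 or -1 separate the mixed terms.\<close>

lemma cubic_eq_0D:
  assumes "\<And>x y. cubic c00 c10 c01 c20 c11 c02 c30 c21 c12 c03 x y = 0"
  shows "c00 = 0 \<and> c10 = 0 \<and> c01 = 0 \<and> c20 = 0 \<and> c11 = 0 \<and> c02 = 0 \<and> c30 = 0 \<and> c21 = 0 \<and> c12 = 0 \<and> c03 = 0"
proof -
  have e: "c00 + c10 * x + c01 * y + c20 * x^2 + c11 * x * y + c02 * y^2
     + c30 * x^3 + c21 * x^2 * y + c12 * x * y^2 + c03 * y^3 = 0" for x y
    using assms[of x y] by (simp add: cubic_def)
  have "c00 = 0" using e[of 0 0] by simp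
  moreover have "c10 + c20 + c30 = 0" "- c10 + c20 - c30 = 0" "2 * c10 + 4 * c20 + 8 * c30 = 0"
    using e[of 1 0] e[of "-1" 0] e[of 2 0] \<open>c00 = 0\<close> by simp_all
  moreover have "c01 + c02 + c03 = 0" "- c01 + c02 - c03 = 0" "2 * c01 + 4 * c02 + 8 * c03 = 0"
    using e[of 0 1] e[of 0 "-1"] e[of 0 2] \<open>c00 = 0\<close> by simp_all
  ultimately have z: "c00 = 0" "c10 = 0" "c20 = 0" "c30 = 0" "c01 = 0" "c02 = 0" "c03 = 0"
    by linarith+
  then have "c11 + c21 + c12 = 0" "- c11 + c21 - c12 = 0" "- c11 - c21 + c12 = 0"
    using e[of 1 1] e[of "-1" 1] e[of 1 "-1"] by simp_all
  then show ?thesis using z by linarith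
qed

text \<open>The line is the image of an affine map of the plane that ignores its second coordinate,
  so the two-variable normal form applies and is read off at \<open>vector [t, 0]\<close>.\<close>

lemma poly_space_3_line:
  assumes "f \<in> poly_space 3"
  shows "\<exists>a0 a1 a2 a3. \<forall>t. f (p + t *\<^sub>R v) = a0 + a1 * t + a2 * t^2 + a3 * t^3"
proof -
  have lin: "(\<lambda>z. (p + z$1 *\<^sub>R v) $ i) \<in> poly_space 1" for i
    using poly_space_add[OF poly_space_const[of "p$i"] poly_space_scale[OF poly_space_monomial[of 1 0 1], of "v$i"]]
    by (simp add: mult.commute)
  obtain c00 c10 c01 c20 c11 c02 c30 c21 c12 c03
    where "(\<lambda>z. f (p + z$1 *\<^sub>R v)) = (\<lambda>p::real^2. cubic c00 c10 c01 c20 c11 c02 c30 c21 c12 c03 (p$1) (p$2))"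
    using poly_space_3_cubic[OF poly_space_compose[OF assms lin lin]] by blast
  from fun_cong[OF this, of "vector [t, 0]" for t]
  have "f (p + t *\<^sub>R v) = c00 + c10 * t + c20 * t^2 + c30 * t^3" for t
    by (simp add: cubic_def)
  then show ?thesis by blast
qed

subsection \<open>Directional derivatives\<close>

lemma dir_deriv_eq: "(f has_derivative f') (at p) \<Longrightarrow> dir_deriv v f p = f' v"
  unfolding dir_deriv_def by (simp add: frechet_derivative_at[symmetric])

lemma dir_deriv_const: "dir_deriv v (\<lambda>p. c) p = 0"
  by (rule dir_deriv_eq) (rule has_derivative_const)

lemma dir_deriv_add:
  assumes "f differentiable at p" "g differentiable at p"
  shows "dir_deriv v (\<lambda>p. f p + g p) p = dir_deriv v f p + dir_deriv v g p"
  using has_derivative_add[OF assms[unfolded frechet_derivative_works]]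
  by (subst dir_deriv_eq) (auto simp: dir_deriv_def)

lemma dir_deriv_scale:
  assumes "f differentiable at p"
  shows "dir_deriv v (\<lambda>p. c * f p) p = c * dir_deriv v f p"
  using has_derivative_mult_right[OF assms[unfolded frechet_derivative_works]]
  by (subst dir_deriv_eq) (auto simp: dir_deriv_def)

lemma dir_deriv_mult:
  assumes "f differentiable at p" "g differentiable at p"
  shows "dir_deriv v (\<lambda>p. f p * g p) p = f p * dir_deriv v g p + dir_deriv v f p * g p"
  using has_derivative_mult[OF assms[unfolded frechet_derivative_works]]
  by (subst dir_deriv_eq) (auto simp: dir_deriv_def)

lemma dir_deriv_bounded_linear: "bounded_linear f \<Longrightarrow> dir_deriv v f p = f v"
  by (rule dir_deriv_eq) (rule bounded_linear_imp_has_derivative)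

text \<open>The degrees of freedom record only the two partial derivatives; this carries their
  vanishing over to every direction, in particular to tangents and normals.\<close>

lemma dir_deriv_axis:
  assumes "f differentiable at p"
  shows "dir_deriv v f p = v$1 * dir_deriv (axis 1 1) f p + v$2 * dir_deriv (axis 2 1) f p"
proof -
  have v: "v = v$1 *\<^sub>R axis 1 1 + v$2 *\<^sub>R axis 2 1"
    by (simp add: vec_eq_iff forall_2 axis_def)
  have lin: "linear (frechet_derivative f (at p))"
    by (rule linear_frechet_derivative[OF assms])
  show ?thesis unfolding dir_deriv_def
    by (subst v) (simp only: linear_add[OF lin] linear_scale[OF lin] real_scaleR_def)
qed

lemma dir_deriv_scaleR:
  assumes "f differentiable at p"
  shows "dir_deriv (c *\<^sub>R v) f p = c * dir_deriv v f p"
  unfolding dir_deriv_def using linear_scale[OF linear_frechet_derivative[OF assms]] by simp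

lemma has_real_derivative_along_line:
  assumes "f differentiable at (p + t *\<^sub>R v)"
  shows "((\<lambda>t. f (p + t *\<^sub>R v)) has_real_derivative dir_deriv v f (p + t *\<^sub>R v)) (at t)"
proof -
  let ?D = "frechet_derivative f (at (p + t *\<^sub>R v))"
  have "((\<lambda>t. p + t *\<^sub>R v) has_derivative (\<lambda>h. h *\<^sub>R v)) (at t)"
    by (auto intro!: derivative_eq_intros)
  moreover have "(f has_derivative ?D) (at (p + t *\<^sub>R v))"
    using assms by (simp add: frechet_derivative_works)
  ultimately have "((\<lambda>t. f (p + t *\<^sub>R v)) has_derivative (\<lambda>h. ?D (h *\<^sub>R v))) (at t)"
    by (rule has_derivative_compose)
  then show ?thesis
    unfolding has_field_derivative_def dir_deriv_def
    by (simp add: linear_scale[OF linear_frechet_derivative[OF assms]] mult.commute[of _ "?D v"])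
qed

lemma real_polynomial_function_differentiable: "real_polynomial_function f \<Longrightarrow> f differentiable at p"
  by (simp add: real_polynomial_function_eq differentiable_at_polynomial_function)

text \<open>Normal derivatives stay polynomial, hence integrable along edges, which the additivity
  of \<open>normal_defect\<close> relies on.\<close>

lemma real_polynomial_function_dir_deriv:
  "real_polynomial_function f \<Longrightarrow> real_polynomial_function (dir_deriv v f)"
proof (induction rule: real_polynomial_function.induct)
  case (linear f)
  then have "dir_deriv v f = (\<lambda>p. f v)" by (simp add: dir_deriv_bounded_linear fun_eq_iff)
  then show ?case by (simp add: real_polynomial_function.intros(2))
next
  case (const c)
  have "dir_deriv v (\<lambda>p. c) = (\<lambda>p. 0)" by (simp add: dir_deriv_const fun_eq_iff)
  then show ?case by (simp add: real_polynomial_function.intros(2))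
next
  case (add f g)
  have "dir_deriv v (\<lambda>p. f p + g p) = (\<lambda>p. dir_deriv v f p + dir_deriv v g p)"
    using add.hyps by (simp add: dir_deriv_add real_polynomial_function_differentiable fun_eq_iff)
  then show ?case using add by (simp add: real_polynomial_function.intros(3))
next
  case (mult f g)
  have "dir_deriv v (\<lambda>p. f p * g p) = (\<lambda>p. f p * dir_deriv v g p + dir_deriv v f p * g p)"
    using mult.hyps by (simp add: dir_deriv_mult real_polynomial_function_differentiable fun_eq_iff)
  then show ?case using mult by (simp add: real_polynomial_function.intros(3) real_polynomial_function.intros(4))
qed

lemma real_polynomial_function_nth: "real_polynomial_function (\<lambda>p::real^'n. p$i)"
  by (rule real_polynomial_function.intros(1)) (rule bounded_linear_vec_nth)

lemma real_polynomial_function_power_intro: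
  "real_polynomial_function f \<Longrightarrow> real_polynomial_function (\<lambda>p. f p ^ k)"
  by (induction k) (auto intro: real_polynomial_function.intros)

lemma poly_space_polynomial: "f \<in> poly_space k \<Longrightarrow> real_polynomial_function f"
  unfolding poly_space_def
proof (induction rule: span_funs_induct)
  case (base f)
  then obtain a b where "f = (\<lambda>p. (p$1)^a * (p$2)^b)" by blast
  then show ?case
    by (auto intro!: real_polynomial_function.intros(4) real_polynomial_function_power_intro real_polynomial_function_nth)
qed (auto intro: real_polynomial_function.intros)

subsection \<open>Edges\<close>

text \<open>Centred at the midpoint with parameter range [-1, 1], so that the parity of powers of t
  can be exploited.\<close>

definition edge_path :: "(4 \<Rightarrow> real^2) \<Rightarrow> 4 \<Rightarrow> real \<Rightarrow> real^2" where
  "edge_path V i t = edge_mid V i + t *\<^sub>R ((1/2) *\<^sub>R (V (i + 1) - V i))"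

lemma edge_path_nth:
  "edge_path V i t $ k = ((1 - t) * V i $ k + (1 + t) * V (i + 1) $ k) / 2"
  by (simp add: edge_path_def edge_mid_def midpoint_def field_simps)

lemma edge_path_ends: "edge_path V i (-1) = V i" "edge_path V i 1 = V (i + 1)"
  by (simp_all add: vec_eq_iff edge_path_nth)

lemma edge_path_0: "edge_path V i 0 = edge_mid V i"
  by (simp add: edge_path_def)

text \<open>The substitution t = 2 s / L - 1 from arc length, combined with the fundamental theorem
  of calculus: an edge integral is computed by exhibiting an antiderivative \<open>G\<close> in
  t.\<close>

lemma edge_integral_eq:
  assumes "V (i + 1) \<noteq> V i"
    and "\<And>t. (G has_real_derivative f (edge_path V i t)) (at t)"
  shows "edge_integral V i f = edge_length V i / 2 * (G 1 - G (-1))"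
proof -
  define L where "L = edge_length V i"
  have L: "L > 0" using assms(1) by (simp add: L_def edge_length_def)
  have path: "edge_path V i (2 * s / L - 1) = V i + s *\<^sub>R edge_tangent V i" for s
    using L unfolding edge_tangent_def L_def[symmetric]
    by (simp add: vec_eq_iff edge_path_nth field_simps)
  have "((\<lambda>s. L / 2 * G (2 * s / L - 1)) has_real_derivative f (V i + s *\<^sub>R edge_tangent V i)) (at s)" for s
  proof -
    have "((\<lambda>s. G (2 * s / L - 1)) has_real_derivative f (edge_path V i (2 * s / L - 1)) * (2 / L)) (at s)"
      by (rule DERIV_chain2[OF assms(2)]) (use L in \<open>auto intro!: derivative_eq_intros\<close>)
    from DERIV_cmult[OF this, of "L/2"]
    have "((\<lambda>s. L / 2 * G (2 * s / L - 1)) has_real_derivative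
        L / 2 * (f (V i + s *\<^sub>R edge_tangent V i) * (2 / L))) (at s)" unfolding path .
    then show ?thesis using L by simp
  qed
  then have "((\<lambda>s. f (V i + s *\<^sub>R edge_tangent V i)) has_integral
      L / 2 * G (2 * L / L - 1) - L / 2 * G (2 * 0 / L - 1)) {0..L}"
    using L by (intro fundamental_theorem_of_calculus)
      (auto simp: has_real_derivative_iff_has_vector_derivative[symmetric] intro: has_field_derivative_at_within)
  then show ?thesis
    using L by (simp add: edge_integral_def L_def[symmetric] integral_unique right_diff_distrib)
qed

lemma integrable_on_edge:
  assumes "real_polynomial_function f"
  shows "(\<lambda>s. f (V i + s *\<^sub>R edge_tangent V i)) integrable_on {0..edge_length V i}"
proof (rule integrable_continuous_real)
  have "continuous_on UNIV f"
    using assms by (simp add: real_polynomial_function_eq continuous_on_polymonial_function)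
  then show "continuous_on {0..edge_length V i} (\<lambda>s. f (V i + s *\<^sub>R edge_tangent V i))"
    by (rule continuous_on_compose2) (auto intro!: continuous_intros)
qed

section \<open>Linearity of edge integrals and of the normal derivative constraints\<close>

lemma edge_integral_add:
  "real_polynomial_function f \<Longrightarrow> real_polynomial_function g \<Longrightarrow>
   edge_integral V i (\<lambda>p. f p + g p) = edge_integral V i f + edge_integral V i g"
  unfolding edge_integral_def by (intro integral_add integrable_on_edge)

lemma edge_integral_scale: "edge_integral V i (\<lambda>p. c * f p) = c * edge_integral V i f"
  unfolding edge_integral_def by (rule integral_mult_right)

text \<open>Difference of the two sides of a constraint. As functionals, the four constraints can be
  joined with the twelve degrees of freedom, and \<open>W_space\<close> is their common kernel in
  the ambient space.\<close>

definition normal_defect :: "(4 \<Rightarrow> real^2) \<Rightarrow> (4 \<Rightarrow> real^2) \<Rightarrow> 4 \<Rightarrow> (real^2 \<Rightarrow> real) \<Rightarrow> real" where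
  "normal_defect V n i w = 1 / edge_length V i * edge_integral V i (dir_deriv (n i) w)
     - 1/2 * (dir_deriv (n i) w (V i) + dir_deriv (n i) w (V (i + 1)))"

lemma normal_defect_add:
  assumes "real_polynomial_function f" "real_polynomial_function g"
  shows "normal_defect V n i (\<lambda>p. f p + g p) = normal_defect V n i f + normal_defect V n i g"
proof -
  have "dir_deriv (n i) (\<lambda>p. f p + g p) = (\<lambda>p. dir_deriv (n i) f p + dir_deriv (n i) g p)"
    using assms by (simp add: dir_deriv_add real_polynomial_function_differentiable fun_eq_iff)
  moreover have "edge_integral V i (\<lambda>p. dir_deriv (n i) f p + dir_deriv (n i) g p)
      = edge_integral V i (dir_deriv (n i) f) + edge_integral V i (dir_deriv (n i) g)"
    using assms by (intro edge_integral_add real_polynomial_function_dir_deriv)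
  ultimately show ?thesis by (simp add: normal_defect_def algebra_simps)
qed

lemma normal_defect_scale:
  assumes "real_polynomial_function f"
  shows "normal_defect V n i (\<lambda>p. c * f p) = c * normal_defect V n i f"
proof -
  have "dir_deriv (n i) (\<lambda>p. c * f p) = (\<lambda>p. c * dir_deriv (n i) f p)"
    using assms by (simp add: dir_deriv_scale real_polynomial_function_differentiable fun_eq_iff)
  then show ?thesis by (simp add: normal_defect_def edge_integral_scale algebra_simps)
qed

section \<open>Traces on an edge and the corrected trapezoidal rule\<close>

lemma has_real_derivative_edge_path:
  assumes "real_polynomial_function f"
  shows "((\<lambda>t. f (edge_path V i t)) has_real_derivative
            dir_deriv ((1/2) *\<^sub>R (V (i + 1) - V i)) f (edge_path V i t)) (at t)"
  unfolding edge_path_def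
  by (intro has_real_derivative_along_line real_polynomial_function_differentiable assms)

text \<open>The power \<open>t^4\<close> is excluded because the corrected trapezoidal rule is not exact for it.\<close>
definition quintic_on_edge :: "(4 \<Rightarrow> real^2) \<Rightarrow> 4 \<Rightarrow> (real^2 \<Rightarrow> real) \<Rightarrow> bool" where
  "quintic_on_edge V i w \<longleftrightarrow>
     (\<exists>a0 a1 a2 a3 a5. \<forall>t. w (edge_path V i t) = a0 + a1 * t + a2 * t^2 + a3 * t^3 + a5 * t^5)"

lemma quintic_on_edge_add:
  assumes "quintic_on_edge V i f" "quintic_on_edge V i g"
  shows "quintic_on_edge V i (\<lambda>p. f p + g p)"
proof -
  obtain a0 a1 a2 a3 a5 b0 b1 b2 b3 b5 where
    "\<And>t. f (edge_path V i t) = a0 + a1 * t + a2 * t^2 + a3 * t^3 + a5 * t^5"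
    "\<And>t. g (edge_path V i t) = b0 + b1 * t + b2 * t^2 + b3 * t^3 + b5 * t^5"
    using assms unfolding quintic_on_edge_def by metis
  then have "\<forall>t. f (edge_path V i t) + g (edge_path V i t)
      = (a0+b0) + (a1+b1) * t + (a2+b2) * t^2 + (a3+b3) * t^3 + (a5+b5) * t^5"
    by (simp add: algebra_simps)
  then show ?thesis unfolding quintic_on_edge_def by blast
qed

lemma quintic_on_edge_scale:
  assumes "quintic_on_edge V i f"
  shows "quintic_on_edge V i (\<lambda>p. c * f p)"
proof -
  obtain a0 a1 a2 a3 a5 where
    "\<And>t. f (edge_path V i t) = a0 + a1 * t + a2 * t^2 + a3 * t^3 + a5 * t^5"
    using assms unfolding quintic_on_edge_def by metis
  then have "\<forall>t. c * f (edge_path V i t)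
      = (c*a0) + (c*a1) * t + (c*a2) * t^2 + (c*a3) * t^3 + (c*a5) * t^5"
    by (simp add: algebra_simps)
  then show ?thesis unfolding quintic_on_edge_def by blast
qed

lemma quintic_on_edge_zero: "(\<And>t. f (edge_path V i t) = 0) \<Longrightarrow> quintic_on_edge V i f"
  unfolding quintic_on_edge_def by (intro exI[of _ 0]) simp

lemma quintic_on_edge_poly_space:
  assumes "f \<in> poly_space 3"
  shows "quintic_on_edge V i f"
proof -
  obtain a0 a1 a2 a3 where "\<And>t. f (edge_path V i t) = a0 + a1 * t + a2 * t^2 + a3 * t^3"
    unfolding edge_path_def using poly_space_3_line[OF assms] by blast
  then have "\<forall>t. f (edge_path V i t) = a0 + a1 * t + a2 * t^2 + a3 * t^3 + 0 * t^5" by simp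
  then show ?thesis unfolding quintic_on_edge_def by blast
qed

text \<open>Odd powers of t drop out of every term: their integral and their endpoint sum vanish,
  and their derivatives are even. Only \<open>a0\<close> and \<open>a2\<close> have to be
  compared.\<close>

lemma corrected_trapezoidal:
  assumes "quintic_on_edge V i w" "real_polynomial_function w" "V (i + 1) \<noteq> V i"
  shows "1 / edge_length V i * edge_integral V i w
            = 1/2 * (w (V i) + w (V (i + 1)))
              - edge_length V i / 12 * (dir_deriv (edge_tangent V i) w (V (i + 1))
                                        - dir_deriv (edge_tangent V i) w (V i))"
proof -
  obtain a0 a1 a2 a3 a5 where
    w: "\<And>t. w (edge_path V i t) = a0 + a1 * t + a2 * t^2 + a3 * t^3 + a5 * t^5"
    using assms unfolding quintic_on_edge_def by metis
  define L where "L = edge_length V i"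
  have L: "L > 0" using assms(3) by (simp add: L_def edge_length_def)
  have "edge_integral V i w = L / 2 * ((\<lambda>t. a0 * t + a1 * t^2/2 + a2 * t^3/3 + a3 * t^4/4 + a5 * t^6/6) 1
       - (\<lambda>t. a0 * t + a1 * t^2/2 + a2 * t^3/3 + a3 * t^4/4 + a5 * t^6/6) (-1))"
    unfolding L_def by (rule edge_integral_eq[OF assms(3)]) (auto intro!: derivative_eq_intros simp: w)
  then have I: "edge_integral V i w = L * (a0 + a2 / 3)" by (simp add: field_simps)
  have "((\<lambda>t. w (edge_path V i t)) has_real_derivative a1 + 2 * a2 * t + 3 * a3 * t^2 + 5 * a5 * t^4) (at t)" for t
    unfolding w by (auto intro!: derivative_eq_intros)
  from DERIV_unique[OF has_real_derivative_edge_path[OF assms(2)] this]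
  have D: "dir_deriv ((1/2) *\<^sub>R (V (i + 1) - V i)) w (edge_path V i t)
      = a1 + 2 * a2 * t + 3 * a3 * t^2 + 5 * a5 * t^4" for t .
  \<comment> \<open>The path covers an edge of length \<open>L\<close> in parameter time 2, so its
    velocity is \<open>L / 2\<close> times the unit tangent.\<close>
  have "(1/2) *\<^sub>R (V (i + 1) - V i) = (L / 2) *\<^sub>R edge_tangent V i"
    using L by (simp add: edge_tangent_def L_def[symmetric])
  then have "L / 2 * dir_deriv (edge_tangent V i) w (edge_path V i t)
      = a1 + 2 * a2 * t + 3 * a3 * t^2 + 5 * a5 * t^4" for t
    using D[of t] real_polynomial_function_differentiable[OF assms(2)] by (simp add: dir_deriv_scaleR)
  from this[of 1] this[of "-1"] have
    "L * (dir_deriv (edge_tangent V i) w (V (i + 1)) - dir_deriv (edge_tangent V i) w (V i)) = 8 * a2"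
    by (simp add: edge_path_ends algebra_simps)
  moreover have "w (V i) + w (V (i + 1)) = 2 * (a0 + a2)"
    using w[of 1] w[of "-1"] by (simp add: edge_path_ends)
  ultimately show ?thesis using I L unfolding L_def[symmetric] by (simp add: field_simps)
qed

text \<open>Double zeros at both ends split off (1 - t^2)^2 and leave a linear cofactor; the absence
  of t^4 removes its constant term.\<close>

lemma quintic_on_edge_zero_dofs:
  assumes "quintic_on_edge V i w" "real_polynomial_function w"
    and "w (V i) = 0" "w (V (i + 1)) = 0"
    and "\<And>v. dir_deriv v w (V i) = 0" "\<And>v. dir_deriv v w (V (i + 1)) = 0"
  shows "\<exists>c. \<forall>t. w (edge_path V i t) = c * t * (1 - t^2)^2"
proof -
  obtain a0 a1 a2 a3 a5 where
    w: "\<And>t. w (edge_path V i t) = a0 + a1 * t + a2 * t^2 + a3 * t^3 + a5 * t^5"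
    using assms(1) unfolding quintic_on_edge_def by metis
  have "((\<lambda>t. w (edge_path V i t)) has_real_derivative a1 + 2 * a2 * t + 3 * a3 * t^2 + 5 * a5 * t^4) (at t)" for t
    unfolding w by (auto intro!: derivative_eq_intros)
  from DERIV_unique[OF has_real_derivative_edge_path[OF assms(2)] this]
  have D: "dir_deriv ((1/2) *\<^sub>R (V (i + 1) - V i)) w (edge_path V i t)
      = a1 + 2 * a2 * t + 3 * a3 * t^2 + 5 * a5 * t^4" for t .
  have "a0 + a1 + a2 + a3 + a5 = 0" "a0 - a1 + a2 - a3 - a5 = 0"
    "a1 + 2 * a2 + 3 * a3 + 5 * a5 = 0" "a1 - 2 * a2 + 3 * a3 + 5 * a5 = 0"
    using w[of 1] w[of "-1"] D[of 1] D[of "-1"] assms(3-6) by (simp_all add: edge_path_ends)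
  then have "a0 = 0" "a2 = 0" "a1 = a5" "a3 = - 2 * a5" by linarith+
  then have "w (edge_path V i t) = a5 * t * (1 - t^2)^2" for t
    using w[of t] by (simp add: power2_eq_square algebra_simps power_numeral_reduce)
  then show ?thesis by blast
qed

subsection \<open>Reference coordinates\<close>

text \<open>Affine coordinates with linear part \<open>A_mat V\<close>: the edge midpoints become the points \<open>(0, \<plusminus>1)\<close>
  and \<open>(\<plusminus>1, 0)\<close>, and \<open>m13\<close>, \<open>m24\<close> become the coordinate functions.\<close>
definition ref_map :: "(4 \<Rightarrow> real^2) \<Rightarrow> real \<Rightarrow> real \<Rightarrow> real^2" where
  "ref_map V x y = (1/4) *\<^sub>R (V 1 + V 2 + V 3 + V 4)
     + x *\<^sub>R ((1/4) *\<^sub>R (V 3 - V 4 - V 1 + V 2)) + y *\<^sub>R ((1/4) *\<^sub>R (V 3 + V 4 - V 1 - V 2))"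

lemma index_4_add:
  "(1::4) + 1 = 2" "(2::4) + 1 = 3" "(3::4) + 1 = 4" "(4::4) + 1 = 1"
  "(1::4) + 2 = 3" "(2::4) + 2 = 4" "(3::4) + 2 = 1" "(4::4) + 2 = 2"
  "(1::4) + 3 = 4" "(2::4) + 3 = 1" "(3::4) + 3 = 2" "(4::4) + 3 = 3"
  by simp_all

lemma poly_space_3_ref_map:
  assumes "f \<in> poly_space 3"
  shows "\<exists>c00 c10 c01 c20 c11 c02 c30 c21 c12 c03. \<forall>x y.
           f (ref_map V x y) = cubic c00 c10 c01 c20 c11 c02 c30 c21 c12 c03 x y"
proof -
  have lin: "(\<lambda>z. ref_map V (z$1) (z$2) $ i) \<in> poly_space 1" for i
    using poly_space_add[OF poly_space_const[of "((1/4) *\<^sub>R (V 1 + V 2 + V 3 + V 4))$i"]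
        poly_space_add[OF
          poly_space_scale[OF poly_space_monomial[of 1 0 1], of "((1/4) *\<^sub>R (V 3 - V 4 - V 1 + V 2))$i"]
          poly_space_scale[OF poly_space_monomial[of 0 1 1], of "((1/4) *\<^sub>R (V 3 + V 4 - V 1 - V 2))$i"]]]
    by (simp add: ref_map_def mult.commute add.assoc)
  obtain c00 c10 c01 c20 c11 c02 c30 c21 c12 c03
    where "(\<lambda>z. f (ref_map V (z$1) (z$2))) = (\<lambda>p::real^2. cubic c00 c10 c01 c20 c11 c02 c30 c21 c12 c03 (p$1) (p$2))"
    using poly_space_3_cubic[OF poly_space_compose[OF assms lin lin]] by blast
  from fun_cong[OF this, of "vector [x, y]" for x y]
  have "f (ref_map V x y) = cubic c00 c10 c01 c20 c11 c02 c30 c21 c12 c03 x y" for x y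
    by simp
  then show ?thesis by blast
qed

lemma A_mat_mult: "A_mat V *v v = v$1 *\<^sub>R ((1/4) *\<^sub>R (V 3 - V 4 - V 1 + V 2))
    + v$2 *\<^sub>R ((1/4) *\<^sub>R (V 3 + V 4 - V 1 - V 2))"
  by (simp add: vec_eq_iff forall_2 A_mat_def matrix_vector_mult_def sum_2 transpose_def vector_def field_simps)

lemma cramer_cross2:
  assumes "cross2 a b \<noteq> 0"
  shows "q = (cross2 q b / cross2 a b) *\<^sub>R a + (cross2 a q / cross2 a b) *\<^sub>R b"
proof -
  have "cross2 a b * q $ k = cross2 q b * a $ k + cross2 a q * b $ k" for k
    using exhaust_2[of k] by (auto simp: cross2_def algebra_simps)
  then show ?thesis using assms by (simp add: vec_eq_iff add_divide_distrib[symmetric] nonzero_eq_divide_eq mult.commute)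
qed

section \<open>Vertices, midpoints and line functions in reference coordinates\<close>

locale convex_quad =
  fixes V :: "4 \<Rightarrow> real^2"
  assumes left: "\<And>i j. j \<noteq> i \<Longrightarrow> j \<noteq> i + 1 \<Longrightarrow> 0 < cross2 (V (i + 1) - V i) (V j - V i)"
begin

abbreviation "s1 \<equiv> s_vec V $ 1"
abbreviation "s2 \<equiv> s_vec V $ 2"
abbreviation "R \<equiv> ref_map V"

text \<open>The determinant of \<open>A_mat V\<close>, by which \<open>ref_map V\<close> scales
  oriented areas.\<close>

definition "jac = cross2 ((1/4) *\<^sub>R (V 3 - V 4 - V 1 + V 2)) ((1/4) *\<^sub>R (V 3 + V 4 - V 1 - V 2))"

lemma triangles:
  "0 < cross2 (V 2 - V 1) (V 3 - V 1)" "0 < cross2 (V 2 - V 1) (V 4 - V 1)"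
  "0 < cross2 (V 3 - V 2) (V 4 - V 2)" "0 < cross2 (V 3 - V 2) (V 1 - V 2)"
  "0 < cross2 (V 4 - V 3) (V 1 - V 3)" "0 < cross2 (V 4 - V 3) (V 2 - V 3)"
  "0 < cross2 (V 1 - V 4) (V 2 - V 4)" "0 < cross2 (V 1 - V 4) (V 3 - V 4)"
  using left[of 3 1] left[of 4 1] left[of 4 2] left[of 1 2] left[of 1 3] left[of 2 3] left[of 2 4] left[of 3 4]
  unfolding index_4_add by simp_all

text \<open>The four triangles form two triangulations of the quadrilateral, one for each diagonal,
  so \<open>jac\<close> is a quarter of its area.\<close>

lemma jac_pos: "jac > 0"
proof -
  have "16 * jac = cross2 (V 2 - V 1) (V 3 - V 1) + cross2 (V 2 - V 1) (V 4 - V 1)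
      + cross2 (V 3 - V 2) (V 4 - V 2) + cross2 (V 4 - V 3) (V 1 - V 3)"
    by (simp add: jac_def cross2_def algebra_simps)
  then show ?thesis using triangles by linarith
qed

lemma A_mat_s_vec: "A_mat V *v s_vec V = d_vec V"
proof -
  have "det (A_mat V) = jac"
    by (simp add: det_2 A_mat_def jac_def cross2_def transpose_def vector_def algebra_simps)
  then have "invertible (A_mat V)" using jac_pos by (simp add: invertible_det_nz)
  then have "A_mat V ** matrix_inv (A_mat V) = mat 1"
    unfolding invertible_def matrix_inv_def by (rule someI2_ex) simp
  then show ?thesis by (simp add: s_vec_def matrix_vector_mul_assoc)
qed

text \<open>The corners of the square [-1, 1]^2 are displaced alternately by s and -s, because
  \<open>d_vec V\<close> is the image of s under \<open>A_mat V\<close>. Thus s measures the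
  deviation from a parallelogram.\<close>

lemma vertices_ref:
  "V 1 = R (-1 + s1) (-1 + s2)" "V 2 = R (1 - s1) (-1 - s2)"
  "V 3 = R (1 + s1) (1 + s2)" "V 4 = R (-1 - s1) (1 - s2)"
proof -
  have d: "s1 * V 3 $ k - s1 * V 4 $ k - s1 * V 1 $ k + s1 * V 2 $ k
      + s2 * V 3 $ k + s2 * V 4 $ k - s2 * V 1 $ k - s2 * V 2 $ k = V 3 $ k - V 4 $ k + V 1 $ k - V 2 $ k" for k
    using arg_cong[OF A_mat_s_vec, of "\<lambda>v. v $ k"] unfolding A_mat_mult
    by (simp add: d_vec_def algebra_simps)
  have "V 1 $ k = R (-1 + s1) (-1 + s2) $ k" "V 2 $ k = R (1 - s1) (-1 - s2) $ k"
    "V 3 $ k = R (1 + s1) (1 + s2) $ k" "V 4 $ k = R (-1 - s1) (1 - s2) $ k" for k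
    using d[of k] by (simp_all add: ref_map_def field_simps)
  then show "V 1 = R (-1 + s1) (-1 + s2)" "V 2 = R (1 - s1) (-1 - s2)"
    "V 3 = R (1 + s1) (1 + s2)" "V 4 = R (-1 - s1) (1 - s2)"
    by (simp_all add: vec_eq_iff)
qed

lemma cross2_ref:
  "cross2 (R x y - R x0 y0) (R x' y' - R x0 y0) = jac * ((x - x0) * (y' - y0) - (y - y0) * (x' - x0))"
proof -
  have diff: "ref_map V x y - R x0 y0 = (x - x0) *\<^sub>R ((1/4) *\<^sub>R (V 3 - V 4 - V 1 + V 2))
      + (y - y0) *\<^sub>R ((1/4) *\<^sub>R (V 3 + V 4 - V 1 - V 2))" for x y
    unfolding ref_map_def by (simp only: scaleR_diff_left) (simp only: algebra_simps)
  have bilinear: "cross2 (a *\<^sub>R u + b *\<^sub>R v) (c *\<^sub>R u + d *\<^sub>R v) = cross2 u v * (a * d - b * c)"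
    for a b c d :: real and u v
    by (simp add: cross2_def algebra_simps)
  show ?thesis unfolding diff bilinear jac_def ..
qed

text \<open>Each bound expresses the orientation of a triangle of three consecutive vertices;
  together they put s into the open diamond |s1| + |s2| < 1. All later denominators are nonzero for
  this reason.\<close>

lemma s_bounds: "s1 + s2 < 1" "s1 - s2 < 1" "s2 - s1 < 1" "- s1 - s2 < 1"
proof -
  have "0 < jac * (4 * (1 - s1 - s2))" "0 < jac * (4 * (1 - s1 + s2))"
    "0 < jac * (4 * (1 + s1 + s2))" "0 < jac * (4 * (1 + s1 - s2))"
    using triangles(2) triangles(1) triangles(3) triangles(5)
    unfolding vertices_ref cross2_ref by (simp_all add: algebra_simps)
  then show "s1 + s2 < 1" "s1 - s2 < 1" "s2 - s1 < 1" "- s1 - s2 < 1"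
    using jac_pos by (simp_all add: zero_less_mult_iff)
qed

lemma s_factors_pos: "0 < 1 - s1" "0 < 1 + s1" "0 < 1 - s2" "0 < 1 + s2"
  "0 < 1 - s1 - s2" "0 < 1 - s1 + s2" "0 < 1 + s1 - s2" "0 < 1 + s1 + s2"
  using s_bounds by linarith+

text \<open>Lets an identity verified in reference coordinates be used at every point of the
  plane.\<close>

lemma ref_map_surj: "\<exists>x y. p = R x y"
proof -
  define c where "c = (1/4) *\<^sub>R (V 1 + V 2 + V 3 + V 4)"
  define a where "a = (1/4) *\<^sub>R (V 3 - V 4 - V 1 + V 2)"
  define b where "b = (1/4) *\<^sub>R (V 3 + V 4 - V 1 - V 2)"
  have "p - c = (cross2 (p - c) b / cross2 a b) *\<^sub>R a + (cross2 a (p - c) / cross2 a b) *\<^sub>R b"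
    using jac_pos by (intro cramer_cross2) (simp add: jac_def a_def b_def)
  then have "p = c + (cross2 (p - c) b / cross2 a b) *\<^sub>R a + (cross2 a (p - c) / cross2 a b) *\<^sub>R b"
    by (simp add: algebra_simps)
  then show ?thesis unfolding ref_map_def a_def b_def c_def by blast
qed

lemma midpoint_ref: "midpoint (R x y) (R x' y') = R ((x + x') / 2) ((y + y') / 2)"
  by (simp add: midpoint_def ref_map_def vec_eq_iff field_simps)

lemma edge_mid_ref:
  "edge_mid V 1 = R 0 (-1)" "edge_mid V 2 = R 1 0" "edge_mid V 3 = R 0 1" "edge_mid V 4 = R (-1) 0"
  unfolding edge_mid_def index_4_add vertices_ref midpoint_ref by simp_all

lemma edge_path_ref:
  "edge_path V 1 t = R (t * (1 - s1)) (-1 - t * s2)"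
  "edge_path V 2 t = R (1 + t * s1) (t * (1 + s2))"
  "edge_path V 3 t = R (- t * (1 + s1)) (1 - t * s2)"
  "edge_path V 4 t = R (-1 + t * s1) (- t * (1 - s2))"
  unfolding edge_path_def edge_mid_ref index_4_add vertices_ref
  by (simp_all add: ref_map_def vec_eq_iff field_simps)

lemma line_function_ref:
  assumes "(x1 - x0) * (y2 - y0) - (y1 - y0) * (x2 - x0) \<noteq> 0"
  shows "line_function (R x0 y0) (R x1 y1) (R x2 y2) (R x y)
    = ((x1 - x0) * (y - y0) - (y1 - y0) * (x - x0)) / ((x1 - x0) * (y2 - y0) - (y1 - y0) * (x2 - x0))"
  using assms jac_pos by (subst line_function_eq) (simp_all add: cross2_ref)

lemma m_ref: "m13 V (R x y) = x" "m24 V (R x y) = y"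
  unfolding m13_def m24_def edge_mid_ref by (simp_all add: line_function_ref)

lemma l_edge_ref:
  "l_edge V 1 (R x y) = ((1 - s1) * (1 + y) + s2 * x) / (2 * (1 - s1))"
  "l_edge V 2 (R x y) = ((1 + s2) * (1 - x) + s1 * y) / (2 * (1 + s2))"
  "l_edge V 3 (R x y) = ((1 + s1) * (1 - y) + s2 * x) / (2 * (1 + s1))"
  "l_edge V 4 (R x y) = ((1 - s2) * (1 + x) + s1 * y) / (2 * (1 - s2))"
proof -
  \<comment> \<open>The facts \<open>d\<close> and \<open>e\<close> evaluate the denominators and
    numerators in the literal shape that \<open>line_function_ref\<close> produces, and
    \<open>h\<close> cancels the common factor 2.\<close>
  have d: "(1 - s1 - (-1 + s1)) * (1 - (-1 + s2)) - (-1 - s2 - (-1 + s2)) * (0 - (-1 + s1)) = 4 * (1 - s1)"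
    "(1 + s1 - (1 - s1)) * (0 - (-1 - s2)) - (1 + s2 - (-1 - s2)) * (-1 - (1 - s1)) = 4 * (1 + s2)"
    "(-1 - s1 - (1 + s1)) * (-1 - (1 + s2)) - (1 - s2 - (1 + s2)) * (0 - (1 + s1)) = 4 * (1 + s1)"
    "(-1 + s1 - (-1 - s1)) * (0 - (1 - s2)) - (-1 + s2 - (1 - s2)) * (1 - (-1 - s1)) = 4 * (1 - s2)"
    by (simp_all add: algebra_simps)
  have e: "(1 - s1 - (-1 + s1)) * (y - (-1 + s2)) - (-1 - s2 - (-1 + s2)) * (x - (-1 + s1)) = 2 * ((1 - s1) * (1 + y) + s2 * x)"
    "(1 + s1 - (1 - s1)) * (y - (-1 - s2)) - (1 + s2 - (-1 - s2)) * (x - (1 - s1)) = 2 * ((1 + s2) * (1 - x) + s1 * y)"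
    "(-1 - s1 - (1 + s1)) * (y - (1 + s2)) - (1 - s2 - (1 + s2)) * (x - (1 + s1)) = 2 * ((1 + s1) * (1 - y) + s2 * x)"
    "(-1 + s1 - (-1 - s1)) * (y - (1 - s2)) - (-1 + s2 - (1 - s2)) * (x - (-1 - s1)) = 2 * ((1 - s2) * (1 + x) + s1 * y)"
    by (simp_all add: algebra_simps)
  have h: "2 * a / (4 * b) = a / (2 * b)" for a b :: real by simp
  show "l_edge V 1 (R x y) = ((1 - s1) * (1 + y) + s2 * x) / (2 * (1 - s1))"
    unfolding l_edge_def index_4_add edge_mid_ref vertices_ref(1,2)
    by (subst line_function_ref; unfold d e h) (use s_factors_pos in auto)
  show "l_edge V 2 (R x y) = ((1 + s2) * (1 - x) + s1 * y) / (2 * (1 + s2))"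
    unfolding l_edge_def index_4_add edge_mid_ref vertices_ref(2,3)
    by (subst line_function_ref; unfold d e h) (use s_factors_pos in auto)
  show "l_edge V 3 (R x y) = ((1 + s1) * (1 - y) + s2 * x) / (2 * (1 + s1))"
    unfolding l_edge_def index_4_add edge_mid_ref vertices_ref(3,4)
    by (subst line_function_ref; unfold d e h) (use s_factors_pos in auto)
  show "l_edge V 4 (R x y) = ((1 - s2) * (1 + x) + s1 * y) / (2 * (1 - s2))"
    unfolding l_edge_def index_4_add edge_mid_ref vertices_ref(4,1)
    by (subst line_function_ref; unfold d e h) (use s_factors_pos in auto)
qed

end

subsection \<open>Cubics and the functions \<open>phi1\<close>, \<open>phi2\<close>\<close>

text \<open>A polynomial of this form is odd in t, so the excluded power t^4 cannot occur.\<close>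

lemma quintic_on_edge_odd:
  assumes "\<And>t. f (edge_path V i t) = K * (1 - t^2) * t * (A + B * t^2)"
  shows "quintic_on_edge V i f"
proof -
  have "\<forall>t. f (edge_path V i t) = 0 + (K * A) * t + 0 * t^2 + (K * (B - A)) * t^3 + (- K * B) * t^5"
    unfolding assms by (simp add: algebra_simps power_numeral_reduce)
  then show ?thesis unfolding quintic_on_edge_def by blast
qed

text \<open>The right side has double zeros at 1 and -1, so the factor A + B t^2 must vanish there
  as well.\<close>

lemma odd_quintic_double_root:
  fixes K A B c :: real
  assumes "\<And>t. K * (1 - t^2) * t * (A + B * t^2) = c * t * (1 - t^2)^2" "K \<noteq> 0"
  shows "A + B = 0"
proof -
  \<comment> \<open>Both sides vanish at t = 1, so two other points are compared; four times the
    first equation plus the second eliminates \<open>c\<close>.\<close>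
  have "K * (A + B / 4) = 3 / 4 * c" "K * (A + 4 * B) = - 3 * c"
    using assms(1)[of "1/2"] assms(1)[of 2] by (simp_all add: field_simps power2_eq_square)
  then have "K * (5 * (A + B)) = 0" by (simp add: algebra_simps)
  then show ?thesis using assms(2) by simp
qed

text \<open>The two cubics on the right meet in the eight nodes and the origin. Eliminating the coefficients
  of \<open>x y\<close>, \<open>x^2 y\<close>, \<open>x y^2\<close> by the affine dependence of the four vertices leaves \<open>c00\<close> times
  \<open>4 (1 - (s1 + s2)^2) (1 - (s1 - s2)^2)\<close>, so a cubic through the eight nodes vanishes at the origin too.\<close>
lemma cubic_vanishing_at_nodes:
  fixes s1 s2 :: real
  assumes s: "s1 + s2 < 1" "s1 - s2 < 1" "s2 - s1 < 1" "- s1 - s2 < 1"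
    and v: "P (-1 + s1) (-1 + s2) = 0" "P (1 - s1) (-1 - s2) = 0"
      "P (1 + s1) (1 + s2) = 0" "P (-1 - s1) (1 - s2) = 0"
    and m: "P 0 (-1) = 0" "P 1 0 = 0" "P 0 1 = 0" "P (-1) 0 = 0"
    and P: "P = cubic c00 c10 c01 c20 c11 c02 c30 c21 c12 c03"
  shows "\<exists>a b. \<forall>x y. P x y =
      a * (((1 - s1) * (1 + y) + s2 * x) * ((1 + s1) * (1 - y) + s2 * x) * y)
    + b * (((1 + s2) * (1 - x) + s1 * y) * ((1 - s2) * (1 + x) + s1 * y) * x)"
proof -
  have pos: "0 < 1 - s1" "0 < 1 + s1" "0 < 1 - s2" "0 < 1 + s2" using s by linarith+
  \<comment> \<open>The four midpoint conditions, added and subtracted in opposite pairs.\<close>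
  have c: "c20 = - c00" "c02 = - c00" "c30 = - c10" "c03 = - c01"
    using m unfolding P cubic_def by simp_all
  \<comment> \<open>\<open>a\<close> and \<open>b\<close> are chosen to match the coefficients of y
    and x: the first product contributes only to y, the second only to x.\<close>
  define a where "a = c01 / ((1 - s1) * (1 + s1))"
  define b where "b = c10 / ((1 - s2) * (1 + s2))"
  have ab: "c01 = a * ((1 - s1) * (1 + s1))" "c10 = b * ((1 - s2) * (1 + s2))"
    using pos by (simp_all add: a_def b_def)
  \<comment> \<open>\<open>u\<close>, \<open>v\<close>, \<open>z\<close> are what is left of the
    coefficients of x y, x^2 y, x y^2 after subtracting the two products.\<close>
  define u where "u = c11 - 2 * a * s2 - 2 * b * s1"
  define v where "v = c21 - a * s2^2 + 2 * b * s1 * s2"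
  define z where "z = c12 + 2 * a * s1 * s2 - b * s1^2"
  have uvz: "c11 = u + 2 * a * s2 + 2 * b * s1" "c21 = v + a * s2^2 - 2 * b * s1 * s2"
    "c12 = z - 2 * a * s1 * s2 + b * s1^2"
    by (simp_all add: u_def v_def z_def)
  let ?Q = "\<lambda>x y. a * (((1 - s1) * (1 + y) + s2 * x) * ((1 + s1) * (1 - y) + s2 * x) * y)
    + b * (((1 + s2) * (1 - x) + s1 * y) * ((1 - s2) * (1 + x) + s1 * y) * x)"
  have rest: "P x y = ?Q x y + (c00 * (1 - x^2 - y^2) + x * y * (u + v * x + z * y))" for x y
    unfolding P cubic_def c ab uvz by algebra
  have Qv: "?Q (-1 + s1) (-1 + s2) = 0" "?Q (1 - s1) (-1 - s2) = 0"
    "?Q (1 + s1) (1 + s2) = 0" "?Q (-1 - s1) (1 - s2) = 0"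
    by algebra+
  have e: "c00 * (1 - (1 - s1)^2 - (1 - s2)^2) + (1 - s1) * (1 - s2) * (u - v * (1 - s1) - z * (1 - s2)) = 0"
    "c00 * (1 - (1 - s1)^2 - (1 + s2)^2) - (1 - s1) * (1 + s2) * (u + v * (1 - s1) - z * (1 + s2)) = 0"
    "c00 * (1 - (1 + s1)^2 - (1 + s2)^2) + (1 + s1) * (1 + s2) * (u + v * (1 + s1) + z * (1 + s2)) = 0"
    "c00 * (1 - (1 + s1)^2 - (1 - s2)^2) - (1 + s1) * (1 - s2) * (u - v * (1 + s1) + z * (1 - s2)) = 0"
    using v unfolding rest Qv by algebra+
  have "c00 * (4 * ((1 - s1 - s2) * (1 + s1 + s2) * (1 - s1 + s2) * (1 + s1 - s2))) = 0"
    using e by algebra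
  moreover have "(1 - s1 - s2) * (1 + s1 + s2) * (1 - s1 + s2) * (1 + s1 - s2) \<noteq> 0" using s by simp
  ultimately have c00: "c00 = 0" by simp
  \<comment> \<open>At a vertex x y is nonzero, so the affine function u + v x + z y vanishes at all
    four vertices and is therefore zero.\<close>
  then have "u - v * (1 - s1) - z * (1 - s2) = 0" "u + v * (1 - s1) - z * (1 + s2) = 0"
    "u + v * (1 + s1) + z * (1 + s2) = 0" "u - v * (1 + s1) + z * (1 - s2) = 0"
    using e pos by simp_all
  then have "u = 0 \<and> v = 0 \<and> z = 0" by algebra
  then show ?thesis using rest c00 by auto
qed

section \<open>Edge traces of the cubic bubbles and of \<open>phi1\<close>,
  \<open>phi2\<close>\<close>

context convex_quad
begin

lemma l_edge_on_adjacent_edges: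
  "l_edge V 2 (edge_path V 1 t) = (1 - s1 + s2) / (2 * (1 + s2)) * (1 - t)"
  "l_edge V 4 (edge_path V 1 t) = (1 - s1 - s2) / (2 * (1 - s2)) * (1 + t)"
  "l_edge V 1 (edge_path V 2 t) = (1 - s1 + s2) / (2 * (1 - s1)) * (1 + t)"
  "l_edge V 3 (edge_path V 2 t) = (1 + s1 + s2) / (2 * (1 + s1)) * (1 - t)"
  "l_edge V 2 (edge_path V 3 t) = (1 + s1 + s2) / (2 * (1 + s2)) * (1 + t)"
  "l_edge V 4 (edge_path V 3 t) = (1 + s1 - s2) / (2 * (1 - s2)) * (1 - t)"
  "l_edge V 1 (edge_path V 4 t) = (1 - s1 - s2) / (2 * (1 - s1)) * (1 - t)"
  "l_edge V 3 (edge_path V 4 t) = (1 + s1 - s2) / (2 * (1 + s1)) * (1 + t)"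
  unfolding edge_path_ref l_edge_ref
  by (simp_all add: algebra_simps add_divide_distrib diff_divide_distrib)

lemma l_edge_on_edge:
  "l_edge V 1 (edge_path V 1 t) = 0" "l_edge V 2 (edge_path V 2 t) = 0"
  "l_edge V 3 (edge_path V 3 t) = 0" "l_edge V 4 (edge_path V 4 t) = 0"
  unfolding edge_path_ref l_edge_ref by (simp_all add: algebra_simps)

lemma b0_on_edge: "b0 V (edge_path V i t) = 0"
  using exhaust_4[of i] by (auto simp: b0_def l_edge_on_edge)

lemma m_on_edge:
  "m13 V (edge_path V 1 t) = t * (1 - s1)" "m24 V (edge_path V 1 t) = -1 - t * s2"
  "m13 V (edge_path V 2 t) = 1 + t * s1" "m24 V (edge_path V 2 t) = t * (1 + s2)"
  "m13 V (edge_path V 3 t) = - t * (1 + s1)" "m24 V (edge_path V 3 t) = 1 - t * s2"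
  "m13 V (edge_path V 4 t) = -1 + t * s1" "m24 V (edge_path V 4 t) = - t * (1 - s2)"
  unfolding edge_path_ref m_ref by simp_all

text \<open>The constant in front of (1 - t^2) t in the trace on edge \<open>i\<close> of l_2 l_4
  m_13 (edges 1 and 3) or l_1 l_3 m_24 (edges 2 and 4).\<close>

definition "edge_factor i = (if i = 1 then (1 - s1 + s2) * (1 - s1 - s2) / (4 * (1 + s2) * (1 - s2)) * (1 - s1)
  else if i = 2 then (1 - s1 + s2) * (1 + s1 + s2) / (4 * (1 - s1) * (1 + s1)) * (1 + s2)
  else if i = 3 then - ((1 + s1 + s2) * (1 + s1 - s2) / (4 * (1 + s2) * (1 - s2)) * (1 + s1))
  else - ((1 - s1 - s2) * (1 + s1 - s2) / (4 * (1 - s1) * (1 + s1)) * (1 - s2)))" for i :: 4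

lemma edge_factor_nonzero: "edge_factor i \<noteq> 0"
  using s_factors_pos unfolding edge_factor_def by auto

text \<open>On the edge in question the two edge functions vanish at opposite ends and the median
  function vanishes at the midpoint.\<close>

lemma cubic_bubbles_on_edge:
  "l_edge V 2 (edge_path V 1 t) * l_edge V 4 (edge_path V 1 t) * m13 V (edge_path V 1 t) = edge_factor 1 * (1 - t^2) * t"
  "l_edge V 1 (edge_path V 2 t) * l_edge V 3 (edge_path V 2 t) * m24 V (edge_path V 2 t) = edge_factor 2 * (1 - t^2) * t"
  "l_edge V 2 (edge_path V 3 t) * l_edge V 4 (edge_path V 3 t) * m13 V (edge_path V 3 t) = edge_factor 3 * (1 - t^2) * t"
  "l_edge V 1 (edge_path V 4 t) * l_edge V 3 (edge_path V 4 t) * m24 V (edge_path V 4 t) = edge_factor 4 * (1 - t^2) * t"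
  unfolding l_edge_on_adjacent_edges m_on_edge edge_factor_def power2_eq_square
  using s_factors_pos by (simp_all add: divide_simps) (simp_all add: algebra_simps)

lemma phi_factored:
  "phi1 V p = (l_edge V 1 p * l_edge V 3 p * m24 V p)
     * ((s2 - 1) * (s2 + 1) * m13 V p - s1 * s2 * m24 V p + s1 * m24 V p * m13 V p)"
  "phi2 V p = (l_edge V 2 p * l_edge V 4 p * m13 V p)
     * ((s1 - 1) * (s1 + 1) * m24 V p - s1 * s2 * m13 V p + s2 * m13 V p * m24 V p)"
  by (simp_all add: phi1_def phi2_def Let_def power2_eq_square algebra_simps)

text \<open>The coefficients of \<open>phi1\<close> and \<open>phi2\<close> make the linear term in
  t of the second factor in \<open>phi_factored\<close> cancel. An even factor times the odd cubic
  trace is odd.\<close>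

lemma phi_on_edge:
  "phi2 V (edge_path V 1 t) = edge_factor 1 * (1 - t^2) * t * ((1 - s1) * (1 + s1) + (- (1 - s1) * s2^2) * t^2)"
  "phi1 V (edge_path V 2 t) = edge_factor 2 * (1 - t^2) * t * ((1 + s2) * (s2 - 1) + ((1 + s2) * s1^2) * t^2)"
  "phi2 V (edge_path V 3 t) = edge_factor 3 * (1 - t^2) * t * ((1 + s1) * (s1 - 1) + ((1 + s1) * s2^2) * t^2)"
  "phi1 V (edge_path V 4 t) = edge_factor 4 * (1 - t^2) * t * ((1 - s2) * (1 + s2) + (- (1 - s2) * s1^2) * t^2)"
  unfolding phi_factored cubic_bubbles_on_edge unfolding m_on_edge
  by (simp_all only: mult_cancel_left) (intro disjI2, algebra)+

lemma phi_on_edge_zero: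
  "phi1 V (edge_path V 1 t) = 0" "phi2 V (edge_path V 2 t) = 0"
  "phi1 V (edge_path V 3 t) = 0" "phi2 V (edge_path V 4 t) = 0"
  by (simp_all add: phi_factored l_edge_on_edge)

lemma quintic_on_edge_phi:
  "quintic_on_edge V i (phi1 V)" "quintic_on_edge V i (phi2 V)"
  using exhaust_4[of i]
    quintic_on_edge_odd[of "phi2 V" V 1, OF phi_on_edge(1)] quintic_on_edge_odd[of "phi1 V" V 2, OF phi_on_edge(2)]
    quintic_on_edge_odd[of "phi2 V" V 3, OF phi_on_edge(3)] quintic_on_edge_odd[of "phi1 V" V 4, OF phi_on_edge(4)]
    quintic_on_edge_zero[of "phi1 V" V 1, OF phi_on_edge_zero(1)] quintic_on_edge_zero[of "phi2 V" V 2, OF phi_on_edge_zero(2)]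
    quintic_on_edge_zero[of "phi1 V" V 3, OF phi_on_edge_zero(3)] quintic_on_edge_zero[of "phi2 V" V 4, OF phi_on_edge_zero(4)]
  by auto

lemma quintic_on_edge_shape:
  assumes "p \<in> poly_space 3"
  shows "quintic_on_edge V i (\<lambda>z. p z + c1 * phi1 V z + c2 * phi2 V z + b0 V z * q z)"
proof -
  have "quintic_on_edge V i (\<lambda>z. b0 V z * q z)"
    by (rule quintic_on_edge_zero) (simp add: b0_on_edge)
  then show ?thesis
    by (intro quintic_on_edge_add quintic_on_edge_scale quintic_on_edge_phi
        quintic_on_edge_poly_space[OF assms])
qed

text \<open>The summand with \<open>b0\<close> is invisible on the boundary, so the edge traces
  alone must eliminate \<open>p\<close>, \<open>c1\<close> and \<open>c2\<close>.\<close>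

lemma zero_dofs_imp_bubble:
  assumes p: "p \<in> poly_space 3"
    and w: "w = (\<lambda>z. p z + c1 * phi1 V z + c2 * phi2 V z + b0 V z * q z)"
    and poly: "real_polynomial_function w"
    and val: "\<And>i. w (V i) = 0" and grad: "\<And>i v. dir_deriv v w (V i) = 0"
  shows "p = (\<lambda>z. 0)" "c1 = 0" "c2 = 0"
proof -
  have edge: "\<exists>c. \<forall>t. w (edge_path V i t) = c * t * (1 - t^2)^2" for i
  proof -
    have "quintic_on_edge V i w" unfolding w by (rule quintic_on_edge_shape[OF p])
    then show ?thesis by (rule quintic_on_edge_zero_dofs[OF _ poly val val grad grad])
  qed
  \<comment> \<open>Every nonzero trace of \<open>phi1\<close> or \<open>phi2\<close> carries the
    factor (1 - t^2) t, so both functions vanish at all vertices and midpoints and these values of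
    \<open>w\<close> are those of \<open>p\<close>.\<close>
  have phi: "phi1 V (edge_path V i t) = 0" "phi2 V (edge_path V i t) = 0" if "t = 0 \<or> t = 1 \<or> t = -1" for i t
  proof -
    have "(1 - t^2) * t = 0" using that by auto
    then have "edge_factor j * (1 - t^2) * t = 0" for j by simp
    then have "phi1 V (edge_path V j t) = 0 \<and> phi2 V (edge_path V j t) = 0" if "j = 1 \<or> j = 2 \<or> j = 3 \<or> j = 4" for j
      using that by (elim disjE) (simp_all only: phi_on_edge phi_on_edge_zero mult_zero_left)
    then show "phi1 V (edge_path V i t) = 0" "phi2 V (edge_path V i t) = 0"
      using exhaust_4[of i] by blast+
  qed
  have "p (edge_path V i t) = 0" if "t = 0 \<or> t = 1 \<or> t = -1" for i t
  proof -
    have "w (edge_path V i t) = 0" using edge[of i] that by auto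
    then show ?thesis unfolding w using phi[OF that, of i] by (simp add: b0_on_edge)
  qed
  then have pm: "p (edge_mid V i) = 0" and pv: "p (V i) = 0" for i
    by (metis edge_path_0, metis edge_path_ends(1))
  obtain c00 c10 c01 c20 c11 c02 c30 c21 c12 c03 where
    P: "\<And>x y. p (R x y) = cubic c00 c10 c01 c20 c11 c02 c30 c21 c12 c03 x y"
    using poly_space_3_ref_map[OF p, of V] by blast
  then have Peq: "(\<lambda>x y. p (R x y)) = cubic c00 c10 c01 c20 c11 c02 c30 c21 c12 c03"
    by (simp add: fun_eq_iff)
  have "\<exists>a b. \<forall>x y. p (R x y) =
      a * (((1 - s1) * (1 + y) + s2 * x) * ((1 + s1) * (1 - y) + s2 * x) * y)
    + b * (((1 + s2) * (1 - x) + s1 * y) * ((1 - s2) * (1 + x) + s1 * y) * x)"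
    by (rule cubic_vanishing_at_nodes[OF s_bounds, where P = "\<lambda>x y. p (R x y)", OF _ _ _ _ _ _ _ _ Peq])
      (simp_all only: vertices_ref[symmetric] edge_mid_ref[symmetric] pv pm)
  then obtain a b where ab: "\<And>x y. p (R x y) =
      a * (((1 - s1) * (1 + y) + s2 * x) * ((1 + s1) * (1 - y) + s2 * x) * y)
    + b * (((1 + s2) * (1 - x) + s1 * y) * ((1 - s2) * (1 + x) + s1 * y) * x)" by blast
  \<comment> \<open>The extra factors are the denominators of the normalized edge functions in
    \<open>l_edge_ref\<close>.\<close>
  define A where "A = a * (4 * (1 - s1) * (1 + s1))"
  define B where "B = b * (4 * (1 + s2) * (1 - s2))"
  have cancel: "e * (4 * g * h) * (u / (2 * g) * (v / (2 * h)) * z) = e * (u * v * z)"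
    if "0 < g" "0 < h" for e g h u v z :: real
    using that by (simp add: field_simps)
  have "p (R x y) = A * (l_edge V 1 (R x y) * l_edge V 3 (R x y) * m24 V (R x y))
      + B * (l_edge V 2 (R x y) * l_edge V 4 (R x y) * m13 V (R x y))" for x y
    unfolding ab l_edge_ref m_ref A_def B_def using s_factors_pos by (simp only: cancel)
  then have pAB: "p z = A * (l_edge V 1 z * l_edge V 3 z * m24 V z)
      + B * (l_edge V 2 z * l_edge V 4 z * m13 V z)" for z
    using ref_map_surj[of z] by blast
  have root: "\<alpha> + \<beta> = 0"
    if "\<And>t. w (edge_path V i t) = edge_factor i * (1 - t^2) * t * (\<alpha> + \<beta> * t^2)" for i \<alpha> \<beta>
    using edge[of i] that odd_quintic_double_root[OF _ edge_factor_nonzero[of i], of \<alpha> \<beta>] by metis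
  \<comment> \<open>\<open>root\<close> is applied on each edge. Opposite edges share the unknown
    \<open>A\<close> or \<open>B\<close>, so subtracting their equations isolates \<open>c1\<close>
    or \<open>c2\<close>.\<close>
  have 1: "B + c2 * ((1 - s1) * (1 + s1)) + c2 * (- (1 - s1) * s2^2) = 0"
    by (rule root[of 1]) (simp only: w pAB b0_on_edge phi_on_edge_zero cubic_bubbles_on_edge phi_on_edge l_edge_on_edge; simp add: algebra_simps)
  have 2: "A + c1 * ((1 + s2) * (s2 - 1)) + c1 * ((1 + s2) * s1^2) = 0"
    by (rule root[of 2]) (simp only: w pAB b0_on_edge phi_on_edge_zero cubic_bubbles_on_edge phi_on_edge l_edge_on_edge; simp add: algebra_simps)
  have 3: "B + c2 * ((1 + s1) * (s1 - 1)) + c2 * ((1 + s1) * s2^2) = 0"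
    by (rule root[of 3]) (simp only: w pAB b0_on_edge phi_on_edge_zero cubic_bubbles_on_edge phi_on_edge l_edge_on_edge; simp add: algebra_simps)
  have 4: "A + c1 * ((1 - s2) * (1 + s2)) + c1 * (- (1 - s2) * s1^2) = 0"
    by (rule root[of 4]) (simp only: w pAB b0_on_edge phi_on_edge_zero cubic_bubbles_on_edge phi_on_edge l_edge_on_edge; simp add: algebra_simps)
  \<comment> \<open>The two products are 1 - (s1 + s2)^2 and 1 - (s1 - s2)^2, whose sum is 2 (1 -
    s1^2 - s2^2).\<close>
  have "0 < (1 - s1 - s2) * (1 + s1 + s2)" "0 < (1 - s1 + s2) * (1 + s1 - s2)"
    using s_factors_pos by simp_all
  then have nz: "1 - s1^2 - s2^2 > 0" by (simp add: algebra_simps power2_eq_square)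
  have "c1 * (2 * (1 - s1^2 - s2^2)) = 0" "c2 * (2 * (1 - s1^2 - s2^2)) = 0"
    using 1 2 3 4 by algebra+
  then show c: "c1 = 0" "c2 = 0" using nz by auto
  then have "A = 0" "B = 0" using 1 2 by auto
  then show "p = (\<lambda>z. 0)" using pAB by (simp add: fun_eq_iff)
qed

end

subsection \<open>Bubbles\<close>

lemma line_function_affine:
  assumes "cross2 (b - a) (c - a) \<noteq> 0"
  shows "\<exists>u k. line_function a b c = (\<lambda>p. u \<bullet> p + k)"
  using theI'[OF ex1_line_function[OF assms]] unfolding line_function_def is_line_function_def by blast

lemma affine_on_edge:
  fixes f :: "real^2 \<Rightarrow> real"
  assumes "\<exists>u k. f = (\<lambda>p. u \<bullet> p + k)"
  shows "f (edge_path V i t) = ((1 - t) * f (V i) + (1 + t) * f (V (i + 1))) / 2"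
  using assms by (auto simp: inner_vec_def sum_2 edge_path_nth field_simps)

lemma affine_polynomial:
  fixes f :: "real^2 \<Rightarrow> real"
  assumes "\<exists>u k. f = (\<lambda>p. u \<bullet> p + k)"
  shows "real_polynomial_function f"
proof -
  obtain u k where "f = (\<lambda>p. u \<bullet> p + k)" using assms by blast
  then show ?thesis
    using real_polynomial_function.intros(3)[OF real_polynomial_function.intros(1)[OF bounded_linear_inner_right]
        real_polynomial_function.intros(2)] by blast
qed

lemma dir_deriv_affine: "dir_deriv v (\<lambda>p. u \<bullet> p + k) p = u \<bullet> v"
  by (rule dir_deriv_eq) (auto intro!: derivative_eq_intros)

text \<open>In the application \<open>r1, \<dots>, r4\<close> are the values of an affine function at the vertices. The
  equations make them alternate in sign, contradicting the dependence \<open>dep\<close> given by the crossing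
  diagonals.\<close>
lemma alternating_signs_nonneg:
  fixes \<alpha>1 \<alpha>2 \<alpha>3 \<alpha>4 \<beta>1 \<beta>2 \<beta>3 \<beta>4 e1 e2 e3 e4 d1 d2 d3 d4 r1 r2 r3 r4 \<delta> :: real
  assumes pos: "0 < \<alpha>1" "0 < \<alpha>2" "0 < \<alpha>3" "0 < \<alpha>4" "0 < \<beta>1" "0 < \<beta>2" "0 < \<beta>3" "0 < \<beta>4"
      "0 < e1" "0 < e2" "0 < e3" "0 < e4" "0 < d1" "0 < d2" "0 < d3" "0 < d4" "0 \<le> \<delta>"
    and eq: "\<alpha>1 * r1 + \<beta>1 * r2 + \<delta> * e1 = 0" "\<alpha>2 * r2 + \<beta>2 * r3 - \<delta> * e2 = 0"
      "\<alpha>3 * r3 + \<beta>3 * r4 + \<delta> * e3 = 0" "\<alpha>4 * r4 + \<beta>4 * r1 - \<delta> * e4 = 0"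
    and dep: "d1 * r1 + d3 * r3 = d2 * r2 + d4 * r4"
  shows "r1 = 0 \<and> r2 = 0 \<and> r3 = 0 \<and> r4 = 0 \<and> \<delta> = 0"
proof (cases "r1 \<le> 0")
  case True
  \<comment> \<open>For \<open>r1\<close> nonpositive the signs propagate backwards, through the
    fourth, third and second equation; the first would give no information on
    \<open>r2\<close>.\<close>
  have de: "0 \<le> \<delta> * e1" "0 \<le> \<delta> * e2" "0 \<le> \<delta> * e3" "0 \<le> \<delta> * e4" using pos by simp_all
  have "\<beta>4 * r1 \<le> 0" using True pos by (simp add: mult_le_0_iff)
  then have "0 \<le> \<alpha>4 * r4" using eq de by linarith
  then have r4: "0 \<le> r4" using pos by (simp add: zero_le_mult_iff)
  then have "0 \<le> \<beta>3 * r4" using pos by simp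
  then have "\<alpha>3 * r3 \<le> 0" using eq de by linarith
  then have r3: "r3 \<le> 0" using pos by (simp add: mult_le_0_iff)
  then have "\<beta>2 * r3 \<le> 0" using pos by (simp add: mult_le_0_iff)
  then have "0 \<le> \<alpha>2 * r2" using eq de by linarith
  then have r2: "0 \<le> r2" using pos by (simp add: zero_le_mult_iff)
  have "d1 * r1 \<le> 0" "d3 * r3 \<le> 0" "0 \<le> d2 * r2" "0 \<le> d4 * r4"
    using pos True r2 r3 r4 by (simp_all add: mult_le_0_iff)
  then have "d1 * r1 = 0" "d3 * r3 = 0" "d2 * r2 = 0" "d4 * r4 = 0" using dep by linarith+
  then show ?thesis using pos eq by auto
next
  case False
  \<comment> \<open>For \<open>r1\<close> positive the signs propagate forwards, starting with the
    first equation, and strictly.\<close>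
  have de: "0 \<le> \<delta> * e1" "0 \<le> \<delta> * e2" "0 \<le> \<delta> * e3" using pos by simp_all
  have "0 < \<alpha>1 * r1" using False pos by simp
  then have "\<beta>1 * r2 < 0" using eq de by linarith
  then have r2: "r2 < 0" using pos by (simp add: mult_less_0_iff)
  then have "\<alpha>2 * r2 < 0" using pos by (simp add: mult_less_0_iff)
  then have "0 < \<beta>2 * r3" using eq de by linarith
  then have r3: "0 < r3" using pos by (simp add: zero_less_mult_iff)
  then have "0 < \<alpha>3 * r3" using pos by simp
  then have "\<beta>3 * r4 < 0" using eq de by linarith
  then have r4: "r4 < 0" using pos by (simp add: mult_less_0_iff)
  have "0 < d1 * r1" "0 < d3 * r3" "d2 * r2 < 0" "d4 * r4 < 0"
    using pos False r2 r3 r4 by (simp_all add: mult_less_0_iff)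
  then show ?thesis using dep by linarith
qed

text \<open>The system is homogeneous, so negating all five unknowns reduces to nonnegative
  \<delta>.\<close>

lemma alternating_signs:
  fixes \<alpha>1 \<alpha>2 \<alpha>3 \<alpha>4 \<beta>1 \<beta>2 \<beta>3 \<beta>4 e1 e2 e3 e4 d1 d2 d3 d4 r1 r2 r3 r4 \<delta> :: real
  assumes pos: "0 < \<alpha>1" "0 < \<alpha>2" "0 < \<alpha>3" "0 < \<alpha>4" "0 < \<beta>1" "0 < \<beta>2" "0 < \<beta>3" "0 < \<beta>4"
      "0 < e1" "0 < e2" "0 < e3" "0 < e4" "0 < d1" "0 < d2" "0 < d3" "0 < d4"
    and eq: "\<alpha>1 * r1 + \<beta>1 * r2 + \<delta> * e1 = 0" "\<alpha>2 * r2 + \<beta>2 * r3 - \<delta> * e2 = 0"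
      "\<alpha>3 * r3 + \<beta>3 * r4 + \<delta> * e3 = 0" "\<alpha>4 * r4 + \<beta>4 * r1 - \<delta> * e4 = 0"
    and dep: "d1 * r1 + d3 * r3 = d2 * r2 + d4 * r4"
  shows "r1 = 0 \<and> r2 = 0 \<and> r3 = 0 \<and> r4 = 0 \<and> \<delta> = 0"
proof (cases "0 \<le> \<delta>")
  case True
  show ?thesis by (rule alternating_signs_nonneg[OF pos True eq dep])
next
  case False
  then have "0 \<le> - \<delta>" by simp
  from alternating_signs_nonneg[OF pos this, where ?r1.0 = "-r1" and ?r2.0 = "-r2" and ?r3.0 = "-r3" and ?r4.0 = "-r4"]
  have "- r1 = 0 \<and> - r2 = 0 \<and> - r3 = 0 \<and> - r4 = 0 \<and> - \<delta> = 0"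
    using eq dep by (simp add: algebra_simps)
  then show ?thesis by simp
qed

lemma edge_unit_normal_spans:
  assumes "edge_unit_normal V i n" "V (i + 1) \<noteq> V i" "u \<bullet> n = 0" "u \<bullet> (V (i + 1) - V i) = 0"
  shows "u = 0"
proof -
  define e where "e = V (i + 1) - V i"
  have e0: "e $ 1 \<noteq> 0 \<or> e $ 2 \<noteq> 0" using assms(2) by (auto simp: e_def vec_eq_iff forall_2)
  have n: "(n$1)^2 + (n$2)^2 = 1"
    using assms(1) by (simp add: edge_unit_normal_def norm_eq_1 inner_vec_def sum_2 power2_eq_square)
  have eqs: "n$1 * e$1 + n$2 * e$2 = 0" "u$1 * n$1 + u$2 * n$2 = 0" "u$1 * e$1 + u$2 * e$2 = 0"
    using assms by (simp_all add: edge_unit_normal_def e_def[symmetric] inner_vec_def sum_2)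
  have pos: "(e$1)^2 + (e$2)^2 > 0" using e0 by (simp add: sum_power2_gt_zero_iff)
  have "u$1 * ((e$1)^2 + (e$2)^2) = 0" "u$2 * ((e$1)^2 + (e$2)^2) = 0"
    using n eqs by algebra+
  then show ?thesis using pos by (auto simp: vec_eq_iff forall_2)
qed

section \<open>Signs of the line functions and the constraints on bubbles\<close>

context convex_quad
begin

lemma vertex_distinct: "V (i + 1) \<noteq> V i"
proof
  assume "V (i + 1) = V i"
  moreover have "(i + 2 \<noteq> i \<and> i + 2 \<noteq> i + 1)" using exhaust_4[of i] by auto
  ultimately show False using left[of "i + 2" i] by (simp add: cross2_def)
qed

text \<open>The value at the midpoint of the opposite edge is the mean of the values at its two
  ends, both of which lie to the left of edge \<open>j\<close>.\<close>

lemma l_edge_denominator: "0 < cross2 (V (j + 1) - V j) (edge_mid V (j + 2) - V j)"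
proof -
  have "cross2 (V (j + 1) - V j) (edge_mid V (j + 2) - V j)
     = (cross2 (V (j + 1) - V j) (V (j + 2) - V j) + cross2 (V (j + 1) - V j) (V (j + 3) - V j)) / 2"
    by (simp add: edge_mid_def midpoint_def cross2_def add.assoc field_simps)
  moreover have "j + 2 \<noteq> j \<and> j + 2 \<noteq> j + 1 \<and> j + 3 \<noteq> j \<and> j + 3 \<noteq> j + 1" using exhaust_4[of j] by auto
  ultimately show ?thesis using left[of "j + 2" j] left[of "j + 3" j] by simp
qed

lemma l_edge_affine: "\<exists>u k. l_edge V j = (\<lambda>p. u \<bullet> p + k)"
  unfolding l_edge_def using l_edge_denominator[of j] by (intro line_function_affine) simp

lemma l_edge_vertex:
  "l_edge V j (V j) = 0" "l_edge V j (V (j + 1)) = 0"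
  "k \<noteq> j \<Longrightarrow> k \<noteq> j + 1 \<Longrightarrow> 0 < l_edge V j (V k)"
  using l_edge_denominator[of j] left[of k j]
  by (simp_all add: l_edge_def line_function_eq) (simp_all add: cross2_def)

lemma diagonal_denominators:
  "0 < cross2 (V 3 - V 1) (V 4 - V 1)" "cross2 (V 4 - V 2) (V 3 - V 2) < 0"
  using triangles(5) triangles(3) by (simp_all add: cross2_def algebra_simps)

lemma diagonal_affine: "\<exists>u k. l13 V = (\<lambda>p. u \<bullet> p + k)" "\<exists>u k. l24 V = (\<lambda>p. u \<bullet> p + k)"
  unfolding l13_def l24_def using diagonal_denominators by (auto intro!: line_function_affine)

text \<open>By convexity each diagonal separates the two remaining vertices; the normalization
  decides which side is positive.\<close>

lemma diagonal_vertex: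
  "l13 V (V 1) = 0" "l13 V (V 3) = 0" "l13 V (V 4) = 1" "l13 V (V 2) < 0"
  "l24 V (V 2) = 0" "l24 V (V 4) = 0" "l24 V (V 3) = 1" "l24 V (V 1) < 0"
proof -
  have "cross2 (V 3 - V 1) (V 2 - V 1) < 0" "0 < cross2 (V 4 - V 2) (V 1 - V 2)"
    using triangles(1,7) by (simp_all add: cross2_def algebra_simps)
  then show "l13 V (V 2) < 0" "l24 V (V 1) < 0"
    using diagonal_denominators unfolding l13_def l24_def
    by (simp_all add: line_function_eq divide_less_0_iff)
  show "l13 V (V 1) = 0" "l13 V (V 3) = 0" "l13 V (V 4) = 1" "l24 V (V 2) = 0" "l24 V (V 4) = 0" "l24 V (V 3) = 1"
    using diagonal_denominators unfolding l13_def l24_def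
    by (simp_all add: line_function_eq) (simp_all add: cross2_def)
qed

text \<open>The product of the diagonal functions vanishes at every vertex, so only the mixed term
  survives along an edge; this is four times its value at the midpoint.\<close>

definition "diag_edge i = l13 V (V i) * l24 V (V (i + 1)) + l13 V (V (i + 1)) * l24 V (V i)"

lemma diagonals_on_edge: "l13 V (edge_path V i t) * l24 V (edge_path V i t) = diag_edge i / 4 * (1 - t^2)"
proof -
  have z: "l13 V (V j) * l24 V (V j) = 0" for j
    using exhaust_4[of j] by (auto simp: diagonal_vertex)
  have "((1 - t) * a + (1 + t) * b) / 2 * (((1 - t) * c + (1 + t) * d) / 2)
      = ((1 - t)^2 * (a * c) + (1 + t)^2 * (b * d)) / 4 + (a * d + b * c) / 4 * (1 - t^2)" for a b c d
    by (simp add: field_simps power2_eq_square)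
  then show ?thesis
    unfolding affine_on_edge[OF diagonal_affine(1)] affine_on_edge[OF diagonal_affine(2)] diag_edge_def
    by (simp add: z)
qed

lemma diag_edge_sign: "0 < diag_edge 1" "diag_edge 2 < 0" "0 < diag_edge 3" "diag_edge 4 < 0"
  unfolding diag_edge_def index_4_add
  using diagonal_vertex by (simp_all add: mult_neg_neg)

lemma b0_factored: "b0 V p = l_edge V i p * (l_edge V (i + 1) p * l_edge V (i + 2) p * l_edge V (i + 3) p)"
proof -
  consider "i = 1" | "i = 2" | "i = 3" | "i = 4" using exhaust_4[of i] by blast
  then show ?thesis by cases (simp_all only: index_4_add b0_def mult_ac)
qed

text \<open>The gradient of the edge function is nonzero and orthogonal to the edge, hence not
  orthogonal to the normal.\<close>

lemma normal_deriv_l_edge: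
  assumes "edge_unit_normal V i n"
  shows "\<exists>D. D \<noteq> 0 \<and> (\<forall>p. dir_deriv n (l_edge V i) p = D)"
proof -
  obtain u k where l: "l_edge V i = (\<lambda>p. u \<bullet> p + k)" using l_edge_affine by blast
  have "i + 2 \<noteq> i" "i + 2 \<noteq> i + 1" using exhaust_4[of i] by auto
  then have "0 < l_edge V i (V (i + 2))" by (rule l_edge_vertex(3))
  moreover have "l_edge V i (V i) = 0" by (rule l_edge_vertex(1))
  ultimately have "u \<noteq> 0" unfolding l by auto
  moreover have "u \<bullet> (V (i + 1) - V i) = 0"
    using l_edge_vertex(1,2)[of i] by (simp add: l inner_diff_right)
  ultimately have "u \<bullet> n \<noteq> 0" using edge_unit_normal_spans[OF assms vertex_distinct] by blast
  then show ?thesis by (auto simp: l dir_deriv_affine)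
qed

text \<open>On edge \<open>i\<close> the normal derivative of the bubble is a constant times the
  other three edge functions times q. The adjacent two give 1 - t^2 up to a constant, so the
  constraint is a mean of q with weight (1 - t^2) times the opposite edge function.\<close>

lemma bubble_constraint:
  assumes n: "edge_unit_normal V i n"
    and r: "\<exists>u k. r = (\<lambda>p. u \<bullet> p + k)"
    and w: "w = (\<lambda>p. b0 V p * (r p + \<delta> * l13 V p * l24 V p))"
    and int: "edge_integral V i (dir_deriv n w) = 0"
  shows "(3 * l_edge V (i + 2) (V i) + 2 * l_edge V (i + 2) (V (i + 1))) * r (V i)
     + (2 * l_edge V (i + 2) (V i) + 3 * l_edge V (i + 2) (V (i + 1))) * r (V (i + 1))
     + \<delta> * ((l_edge V (i + 2) (V i) + l_edge V (i + 2) (V (i + 1))) * diag_edge i) = 0"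
proof -
  define g where "g p = l_edge V (i + 1) p * l_edge V (i + 2) p * l_edge V (i + 3) p * (r p + \<delta> * l13 V p * l24 V p)" for p
  have polys: "real_polynomial_function (l_edge V i)" "real_polynomial_function g"
    unfolding g_def by (intro real_polynomial_function.intros affine_polynomial l_edge_affine diagonal_affine r)+
  have wg: "w = (\<lambda>p. l_edge V i p * g p)" by (simp add: w g_def b0_factored[of _ i] fun_eq_iff)
  obtain D where D: "D \<noteq> 0" "\<And>p. dir_deriv n (l_edge V i) p = D" using normal_deriv_l_edge[OF n] by blast
  have "l_edge V i (edge_path V i t) = 0" for t
    by (simp add: affine_on_edge[OF l_edge_affine] l_edge_vertex)
  \<comment> \<open>In the product rule the term with the undifferentiated edge function
    vanishes.\<close>
  then have dw: "dir_deriv n w (edge_path V i t) = D * g (edge_path V i t)" for t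
    unfolding wg by (subst dir_deriv_mult) (auto simp: polys real_polynomial_function_differentiable D)
  define a where "a = l_edge V (i + 1) (V i)"
  define b where "b = l_edge V (i + 3) (V (i + 1))"
  define A where "A = l_edge V (i + 2) (V i)"
  define B where "B = l_edge V (i + 2) (V (i + 1))"
  define r0 where "r0 = r (V i)"
  define r1 where "r1 = r (V (i + 1))"
  define E where "E = diag_edge i"
  have idx: "i \<noteq> i + 1" "i \<noteq> i + 1 + 1" "i + 1 \<noteq> i + 3" "i + 1 \<noteq> i + 3 + 1" "i + 3 + 1 = i"
    using exhaust_4[of i] by auto
  have ab: "a > 0" "b > 0" using l_edge_vertex(3)[of i "i + 1"] l_edge_vertex(3)[of "i + 1" "i + 3"] idx
    by (simp_all add: a_def b_def)
  have l: "l_edge V (i + 1) (edge_path V i t) = (1 - t) * a / 2"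
    "l_edge V (i + 3) (edge_path V i t) = (1 + t) * b / 2"
    "l_edge V (i + 2) (edge_path V i t) = ((1 - t) * A + (1 + t) * B) / 2" for t
    using l_edge_vertex(1)[of "i + 1"] l_edge_vertex(2)[of "i + 3"] idx
    by (simp_all add: affine_on_edge[OF l_edge_affine] a_def b_def A_def B_def)
  have q: "r (edge_path V i t) + \<delta> * l13 V (edge_path V i t) * l24 V (edge_path V i t)
     = ((1 - t) * r0 + (1 + t) * r1) / 2 + \<delta> * (E / 4 * (1 - t^2))" for t
    by (simp add: affine_on_edge[OF r] diagonals_on_edge mult.assoc r0_def r1_def E_def)
  \<comment> \<open>Sums and differences of endpoint values turn the affine factors into S + T t and
    X + Y t, which separates even from odd powers.\<close>
  define S T X Y Z C where defs: "S = A + B" "T = B - A" "X = (r0 + r1) / 2" "Y = (r1 - r0) / 2" "Z = \<delta> * E / 4"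
    "C = D * a * b / 8"
  have dw': "dir_deriv n w (edge_path V i t) = C * ((1 - t^2) * (S + T * t) * (X + Y * t + Z * (1 - t^2)))" for t
    unfolding dw g_def l q defs by (simp add: field_simps power2_eq_square)
  \<comment> \<open>Coefficients of the antiderivative of the expanded quintic in
    \<open>dw'\<close>.\<close>
  define g1 g2 g3 g4 g5 g6 where coeffs: "g1 = C * (S * X + Z * S)" "g2 = C * (S * Y + T * X + Z * T) / 2"
    "g3 = C * (T * Y - S * X - 2 * Z * S) / 3" "g4 = C * (- (S * Y + T * X) - 2 * Z * T) / 4"
    "g5 = C * (- (T * Y) + Z * S) / 5" "g6 = C * (Z * T) / 6"
  have scaled: "2 * g2 = C * (S * Y + T * X + Z * T)" "3 * g3 = C * (T * Y - S * X - 2 * Z * S)"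
    "4 * g4 = C * (- (S * Y + T * X) - 2 * Z * T)" "5 * g5 = C * (- (T * Y) + Z * S)" "6 * g6 = C * (Z * T)"
    by (simp_all add: coeffs)
  define G where "G t = g1 * t + g2 * t^2 + g3 * t^3 + g4 * t^4 + g5 * t^5 + g6 * t^6" for t
  have "dir_deriv n w (edge_path V i t)
      = g1 + 2 * g2 * t + 3 * g3 * t^2 + 4 * g4 * t^3 + 5 * g5 * t^4 + 6 * g6 * t^5" for t
    unfolding dw' coeffs(1) scaled by (simp add: algebra_simps power_numeral_reduce)
  then have "(G has_real_derivative dir_deriv n w (edge_path V i t)) (at t)" for t
    unfolding G_def by (auto intro!: derivative_eq_intros)
  from edge_integral_eq[OF vertex_distinct this] have "edge_length V i / 2 * (G 1 - G (-1)) = 0" using int by simp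
  moreover have "edge_length V i \<noteq> 0" using vertex_distinct[of i] by (simp add: edge_length_def)
  ultimately have "G 1 - G (-1) = 0" by simp
  \<comment> \<open>The integrals over [-1, 1] of 1 - t^2, (1 - t^2) t^2 and (1 - t^2)^2 are 4/3,
    4/15 and 16/15.\<close>
  moreover have "G 1 - G (-1) = C * (4 / 15 * (5 * S * X + T * Y + 4 * S * Z))"
    unfolding G_def coeffs by (simp add: field_simps)
  moreover have "C \<noteq> 0" using D ab by (simp add: defs)
  ultimately have "5 * S * X + T * Y + 4 * S * Z = 0" by simp
  then show ?thesis
    unfolding A_def[symmetric] B_def[symmetric] r0_def[symmetric] r1_def[symmetric] E_def[symmetric]
    by (simp add: defs field_simps)
qed

lemma bubble_zero:
  assumes n: "\<And>i. edge_unit_normal V i (n i)"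
    and w: "w = (\<lambda>p. b0 V p * (\<alpha> + \<beta> * p$1 + \<gamma> * p$2 + \<delta> * l13 V p * l24 V p))"
    and int: "\<And>i. edge_integral V i (dir_deriv (n i) w) = 0"
  shows "\<alpha> = 0 \<and> \<beta> = 0 \<and> \<gamma> = 0 \<and> \<delta> = 0"
proof -
  define r where "r p = \<alpha> + \<beta> * p$1 + \<gamma> * p$2" for p :: "real^2"
  have "r = (\<lambda>p. vector [\<beta>, \<gamma>] \<bullet> p + \<alpha>)" by (simp add: r_def fun_eq_iff inner_vec_def sum_2)
  then have r: "\<exists>u k. r = (\<lambda>p. u \<bullet> p + k)" by blast
  have w': "w = (\<lambda>p. b0 V p * (r p + \<delta> * l13 V p * l24 V p))" by (simp add: w r_def)
  define A where "A i = l_edge V (i + 2) (V i)" for i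
  define B where "B i = l_edge V (i + 2) (V (i + 1))" for i
  have eq: "(3 * A i + 2 * B i) * r (V i) + (2 * A i + 3 * B i) * r (V (i + 1)) + \<delta> * ((A i + B i) * diag_edge i) = 0" for i
    using bubble_constraint[OF n r w' int, of i] by (simp add: A_def B_def)
  have AB: "A i > 0" "B i > 0" for i
  proof -
    have "i \<noteq> i + 2 \<and> i \<noteq> i + 2 + 1 \<and> i + 1 \<noteq> i + 2 \<and> i + 1 \<noteq> i + 2 + 1" using exhaust_4[of i] by auto
    then show "A i > 0" "B i > 0" unfolding A_def B_def by (auto intro: l_edge_vertex(3))
  qed
  have P: "3 * A i + 2 * B i > 0" "2 * A i + 3 * B i > 0" "A i + B i > 0" for i using AB[of i] by simp_all
  \<comment> \<open>Triangle areas are the weights in the affine dependence of the four vertices: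
    both sides are proportional to the value of \<open>r\<close> at the crossing of the
    diagonals.\<close>
  have dep: "cross2 (V 3 - V 2) (V 4 - V 2) * r (V 1) + cross2 (V 2 - V 1) (V 4 - V 1) * r (V 3)
      = cross2 (V 4 - V 3) (V 1 - V 3) * r (V 2) + cross2 (V 2 - V 1) (V 3 - V 1) * r (V 4)"
    by (simp add: r_def cross2_def algebra_simps)
  \<comment> \<open>\<open>diag_edge\<close> is negative on edges 2 and 4, so its negative supplies
    the positive weights there and the sign of the \<delta> term alternates.\<close>
  have "r (V 1) = 0 \<and> r (V 2) = 0 \<and> r (V 3) = 0 \<and> r (V 4) = 0 \<and> \<delta> = 0"
    by (rule alternating_signs[OF P(1)[of 1] P(1)[of 2] P(1)[of 3] P(1)[of 4] P(2)[of 1] P(2)[of 2] P(2)[of 3] P(2)[of 4]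
          _ _ _ _ triangles(3) triangles(5) triangles(2) triangles(1) _ _ _ _ dep,
          of "(A 1 + B 1) * diag_edge 1" "- ((A 2 + B 2) * diag_edge 2)" "(A 3 + B 3) * diag_edge 3" "- ((A 4 + B 4) * diag_edge 4)"])
      (use eq[of 1] eq[of 2] eq[of 3] eq[of 4, unfolded index_4_add] P(3) diag_edge_sign in
        \<open>simp_all add: index_4_add mult_pos_neg\<close>)
  then have z: "r (V 1) = 0" "r (V 2) = 0" "r (V 3) = 0" "\<delta> = 0" by simp_all
  \<comment> \<open>An affine function that vanishes at three noncollinear points is zero.\<close>
  have "\<beta> * cross2 (V 2 - V 1) (V 3 - V 1) = 0" "\<gamma> * cross2 (V 2 - V 1) (V 3 - V 1) = 0"
    using z(1-3) unfolding r_def cross2_def vector_minus_component by algebra+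
  then have "\<beta> = 0" "\<gamma> = 0" using triangles(1) by auto
  then show ?thesis using z by (simp add: r_def)
qed

end

subsection \<open>Unisolvence and dimension\<close>

text \<open>Surjectivity yields elements \<open>N j\<close> dual to the functionals, hence
  independent; injectivity makes them span. Linearity is asked only on \<open>W\<close>, since
  \<open>tau\<close> is linear only where derivatives exist.\<close>

lemma (in vector_space) dim_eq_card_functionals:
  assumes sub: "subspace W" and fin: "finite J"
    and add: "\<And>j v w. j \<in> J \<Longrightarrow> v \<in> W \<Longrightarrow> w \<in> W \<Longrightarrow> T j (v + w) = T j v + T j w"
    and scale: "\<And>j c v. j \<in> J \<Longrightarrow> v \<in> W \<Longrightarrow> T j (scale c v) = c * T j v"
    and inj: "\<And>w. w \<in> W \<Longrightarrow> (\<And>j. j \<in> J \<Longrightarrow> T j w = 0) \<Longrightarrow> w = 0"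
    and surj: "\<And>g. \<exists>w\<in>W. \<forall>j\<in>J. T j w = g j"
  shows "dim W = card J"
proof -
  have "\<exists>w\<in>W. \<forall>k\<in>J. T k w = (if k = j then 1 else 0)" for j by (rule surj)
  then obtain N where N: "\<And>j. N j \<in> W" "\<And>j k. k \<in> J \<Longrightarrow> T k (N j) = (if k = j then 1 else 0)"
    by metis
  have sum_W: "(\<Sum>j\<in>S. scale (c j) (N j)) \<in> W" for c S
    by (intro subspace_sum[OF sub] subspace_scale[OF sub] N)
  have T0: "T k 0 = 0" if "k \<in> J" for k
    using scale[OF that subspace_0[OF sub], of 0] by simp
  have T_sum: "T k (\<Sum>j\<in>S. scale (c j) (N j)) = (\<Sum>j\<in>S. c j * T k (N j))" if "finite S" "k \<in> J" for c S k
    using that(1)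
  proof (induction S)
    case (insert x S)
    then show ?case
      using add[OF that(2) subspace_scale[OF sub N(1)] sum_W, of "c x" x c S] scale[OF that(2) N(1), of "c x" x]
      by simp
  qed (simp add: T0 that)
  have T_comb: "T k (\<Sum>j\<in>J. scale (c j) (N j)) = c k" if "k \<in> J" for c k
    unfolding T_sum[OF fin that] using that fin by (simp add: N if_distrib[of "\<lambda>x. c _ * x"] cong: if_cong)
  have inj_N: "inj_on N J"
  proof (rule inj_onI)
    fix i j assume "i \<in> J" "j \<in> J" "N i = N j"
    then show "i = j" using N(2)[of i i] N(2)[of i j] by (auto split: if_splits)
  qed
  have "independent (N ` J)"
  proof (rule independent_if_scalars_zero)
    fix f x assume z: "(\<Sum>x\<in>N ` J. scale (f x) x) = 0" and "x \<in> N ` J"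
    then obtain k where k: "k \<in> J" "x = N k" by blast
    have "(\<Sum>j\<in>J. scale (f (N j)) (N j)) = 0" using z by (simp add: sum.reindex[OF inj_N])
    then show "f x = 0" using T_comb[OF k(1), of "\<lambda>j. f (N j)"] T0[OF k(1)] k(2) by simp
  qed (use fin in simp)
  moreover have "W \<subseteq> span (N ` J)"
  proof
    fix w assume w: "w \<in> W"
    \<comment> \<open>The interpolant of \<open>w\<close>; all functionals vanish on the
      difference.\<close>
    let ?u = "\<Sum>j\<in>J. scale (T j w) (N j)"
    have "T k (w + scale (- 1) ?u) = 0" if "k \<in> J" for k
      unfolding add[OF that w subspace_scale[OF sub sum_W]] scale[OF that sum_W] T_comb[OF that] by simp
    then have "w + scale (- 1) ?u = 0"
      by (rule inj[OF subspace_add[OF sub w subspace_scale[OF sub sum_W]]])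
    then have "w = ?u" by simp
    moreover have "?u \<in> span (N ` J)" by (intro span_sum span_scale span_base) simp
    ultimately show "w \<in> span (N ` J)" by simp
  qed
  ultimately show ?thesis
    using N(1) by (intro dim_unique[of "N ` J"]) (auto simp: card_image[OF inj_N])
qed

section \<open>Derivatives of polynomials and the constraints on quadratics\<close>

lemma dir_deriv_poly_space:
  assumes "f \<in> poly_space (Suc k)"
  shows "dir_deriv v f \<in> poly_space k"
proof -
  \<comment> \<open>Polynomiality is carried through the induction to supply
    differentiability.\<close>
  have "real_polynomial_function f \<and> dir_deriv v f \<in> poly_space k"
    using assms unfolding poly_space_def[of "Suc k"]
  proof (induction rule: span_funs_induct)
    case zero
    have "dir_deriv v (\<lambda>p. 0) = (\<lambda>p. 0)" by (simp add: dir_deriv_const fun_eq_iff)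
    then show ?case by (simp add: poly_space_const real_polynomial_function.intros(2))
  next
    case (add f g)
    then have "dir_deriv v (\<lambda>p. f p + g p) = (\<lambda>p. dir_deriv v f p + dir_deriv v g p)"
      by (simp add: dir_deriv_add real_polynomial_function_differentiable fun_eq_iff)
    then show ?case using add by (simp add: poly_space_add real_polynomial_function.intros(3))
  next
    case (scale c f)
    then have "dir_deriv v (\<lambda>p. c * f p) = (\<lambda>p. c * dir_deriv v f p)"
      by (simp add: dir_deriv_scale real_polynomial_function_differentiable fun_eq_iff)
    then show ?case using scale by (simp add: poly_space_scale real_polynomial_function.intros(2,4))
  next
    case (base f)
    then obtain a b where f: "f = (\<lambda>p. (p$1)^a * (p$2)^b)" "a + b \<le> Suc k" by auto
    have D: "(f has_derivative (\<lambda>h. (p$1)^a * (real b * (h$2) * (p$2)^(b - 1)) + (real a * (h$1) * (p$1)^(a - 1)) * (p$2)^b)) (at p)" for p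
      unfolding f(1) by (auto intro!: derivative_eq_intros bounded_linear.has_derivative[OF bounded_linear_vec_nth])
    then have d: "dir_deriv v f = (\<lambda>p. real b * v$2 * ((p$1)^a * (p$2)^(b - 1)) + real a * v$1 * ((p$1)^(a - 1) * (p$2)^b))"
      by (simp add: dir_deriv_eq[OF D] fun_eq_iff)
    have "(\<lambda>p. real b * v$2 * ((p$1)^a * (p$2)^(b - 1))) \<in> poly_space k"
    \<comment> \<open>For b = 0 the truncated exponent \<open>b - 1\<close> does not lower the
      degree, but the coefficient is zero.\<close>
    proof (cases "b = 0")
      case False
      then show ?thesis using f(2) by (intro poly_space_scale poly_space_monomial) simp
    qed (simp add: poly_space_const)
    moreover have "(\<lambda>p. real a * v$1 * ((p$1)^(a - 1) * (p$2)^b)) \<in> poly_space k"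
    proof (cases "a = 0")
      case False
      then show ?thesis using f(2) by (intro poly_space_scale poly_space_monomial) simp
    qed (simp add: poly_space_const)
    moreover have "f \<in> poly_space (Suc k)" unfolding f(1) by (rule poly_space_monomial) (rule f(2))
    ultimately show ?case unfolding d by (simp add: poly_space_add poly_space_polynomial)
  qed
  then show ?thesis ..
qed

lemma poly_space_1_affine:
  assumes "f \<in> poly_space 1"
  shows "\<exists>u k. f = (\<lambda>p. u \<bullet> p + k)"
  using assms unfolding poly_space_def
proof (induction rule: span_funs_induct)
  case zero
  show ?case by (intro exI[of _ 0]) simp
next
  case (add f g)
  then obtain u k u' k' where "f = (\<lambda>p. u \<bullet> p + k)" "g = (\<lambda>p. u' \<bullet> p + k')" by blast
  then show ?case by (intro exI[of _ "u + u'"] exI[of _ "k + k'"]) (simp add: inner_add_left fun_eq_iff)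
next
  case (scale c f)
  then obtain u k where "f = (\<lambda>p. u \<bullet> p + k)" by blast
  then show ?case by (intro exI[of _ "c *\<^sub>R u"] exI[of _ "c * k"]) (simp add: distrib_left fun_eq_iff)
next
  case (base f)
  then obtain a b where f: "f = (\<lambda>p. (p$1)^a * (p$2)^b)" "a + b \<le> 1" by auto
  then consider "a = 0" "b = 0" | "a = 1" "b = 0" | "a = 0" "b = 1" by linarith
  then show ?case
  proof cases
    case 1
    then show ?thesis by (intro exI[of _ 0] exI[of _ 1]) (simp add: f)
  next
    case 2
    then show ?thesis by (intro exI[of _ "axis 1 1"] exI[of _ 0]) (simp add: f inner_axis')
  next
    case 3
    then show ?thesis by (intro exI[of _ "axis 2 1"] exI[of _ 0]) (simp add: f inner_axis')
  qed
qed

text \<open>The derivative of a quadratic is affine, and the trapezoidal rule is exact for affine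
  functions.\<close>

lemma normal_defect_poly_space_2:
  assumes "f \<in> poly_space 2" "V (i + 1) \<noteq> V i"
  shows "normal_defect V n i f = 0"
proof -
  have "dir_deriv (n i) f \<in> poly_space 1" using dir_deriv_poly_space[of f 1] assms(1) by (simp add: numeral_2_eq_2)
  note path = affine_on_edge[OF poly_space_1_affine[OF this], of V i]
  define a b where "a = dir_deriv (n i) f (V i)" and "b = dir_deriv (n i) f (V (i + 1))"
  have "((\<lambda>t. (a + b) / 2 * t + (b - a) / 4 * t^2) has_real_derivative dir_deriv (n i) f (edge_path V i t)) (at t)" for t
    unfolding path a_def[symmetric] b_def[symmetric]
    by (auto intro!: derivative_eq_intros simp: field_simps)
  from edge_integral_eq[OF assms(2) this]
  have "edge_integral V i (dir_deriv (n i) f) = edge_length V i / 2 * (a + b)" by (simp add: field_simps)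
  moreover have "edge_length V i \<noteq> 0" using assms(2) by (simp add: edge_length_def)
  ultimately show ?thesis by (simp add: normal_defect_def a_def b_def)
qed

section \<open>The ambient space as the image of sixteen coefficients\<close>

type_synonym coeffs = "(real^4) \<times> (real^4) \<times> (real^4) \<times> (real^4)"

text \<open>Ten cubic coefficients, two for \<open>phi1\<close> and \<open>phi2\<close>, four for
  bubbles. The blocks of four match the three families of nodal values and the four constraints, so
  that source and target of the evaluation map are the same Euclidean space.\<close>

definition shape_fun :: "(4 \<Rightarrow> real^2) \<Rightarrow> coeffs \<Rightarrow> real^2 \<Rightarrow> real" where
  "shape_fun V = (\<lambda>(a, b, c, d) p.
     cubic (a$1) (a$2) (a$3) (a$4) (b$1) (b$2) (b$3) (b$4) (c$1) (c$2) (p$1) (p$2)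
     + c$3 * phi1 V p + c$4 * phi2 V p
     + b0 V p * (d$1 + d$2 * p$1 + d$3 * p$2 + d$4 * l13 V p * l24 V p))"

lemma shape_fun_add: "shape_fun V (x + y) = (\<lambda>p. shape_fun V x p + shape_fun V y p)"
  by (cases x rule: prod_cases4; cases y rule: prod_cases4)
    (simp add: shape_fun_def cubic_def fun_eq_iff algebra_simps)

lemma shape_fun_scale: "shape_fun V (r *\<^sub>R x) = (\<lambda>p. r * shape_fun V x p)"
  by (cases x rule: prod_cases4) (simp add: shape_fun_def cubic_def fun_eq_iff algebra_simps)

lemma span_insert_funs:
  "f \<in> funs.span (insert g S) \<longleftrightarrow> (\<exists>k h. h \<in> funs.span S \<and> f = (\<lambda>p. k * g p + h p))"
  unfolding funs.span_insert
proof safe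
  fix k assume "f - scale_fun k g \<in> funs.span S"
  moreover have "f = (\<lambda>p. k * g p + (f - scale_fun k g) p)" by (simp add: scale_fun_def fun_eq_iff)
  ultimately show "\<exists>k h. h \<in> funs.span S \<and> f = (\<lambda>p. k * g p + h p)" by blast
next
  fix k h assume "h \<in> funs.span S"
  moreover have "(\<lambda>p. k * g p + h p) - scale_fun k g = h" by (simp add: scale_fun_def fun_eq_iff)
  ultimately show "\<exists>k'. (\<lambda>p. k * g p + h p) - scale_fun k' g \<in> funs.span S" by metis
qed

lemma W_sum_eq_range: "{u + v |u v. u \<in> W_minus V \<and> v \<in> W_bubble V} = range (shape_fun V)"
proof safe
  fix u v assume "u \<in> W_minus V" "v \<in> W_bubble V"
  then obtain p s where p3: "p \<in> poly_space 3" and s: "s \<in> funs.span {phi1 V, phi2 V}" and u: "u = p + s"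
    by (auto simp: W_minus_def)
  obtain c00 c10 c01 c20 c11 c02 c30 c21 c12 c03
    where p: "p = (\<lambda>z. cubic c00 c10 c01 c20 c11 c02 c30 c21 c12 c03 (z$1) (z$2))"
    using poly_space_3_cubic[OF p3] by blast
  obtain c1 c2 where s: "s = (\<lambda>p. c1 * phi1 V p + c2 * phi2 V p)"
    using s unfolding span_insert_funs funs.span_empty by (auto simp: zero_fun_def)
  obtain d1 d2 d3 d4 where v: "v = (\<lambda>p. d1 * b0 V p + (d2 * (b0 V p * p$1) + (d3 * (b0 V p * p$2) + d4 * (b0 V p * l13 V p * l24 V p))))"
    using \<open>v \<in> W_bubble V\<close> unfolding W_bubble_def span_insert_funs funs.span_empty
    by (auto simp: zero_fun_def)
  define vec4 where "vec4 x y z w = (\<chi> i::4. if i = 1 then x else if i = 2 then y else if i = 3 then z else (w::real))" for x y z w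
  have [simp]: "vec4 x y z w $ 1 = x" "vec4 x y z w $ 2 = y" "vec4 x y z w $ 3 = z" "vec4 x y z w $ 4 = w" for x y z w
    by (simp_all add: vec4_def)
  have "u + v = shape_fun V (vec4 c00 c10 c01 c20, vec4 c11 c02 c30 c21, vec4 c12 c03 c1 c2, vec4 d1 d2 d3 d4)"
    by (simp add: u p s v shape_fun_def fun_eq_iff algebra_simps)
  then show "u + v \<in> range (shape_fun V)" by simp
next
  fix x :: coeffs
  obtain a b c d where x: "x = (a, b, c, d)" by (rule prod_cases4)
  define p where "p = (\<lambda>z::real^2. cubic (a$1) (a$2) (a$3) (a$4) (b$1) (b$2) (b$3) (b$4) (c$1) (c$2) (z$1) (z$2))"
  \<comment> \<open>Nesting and trailing zero follow the shape obtained by peeling generators with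
    \<open>span_insert_funs\<close> down to the empty set.\<close>
  define s where "s = (\<lambda>p. c$3 * phi1 V p + (c$4 * phi2 V p + 0))"
  define v where "v = (\<lambda>p. d$1 * b0 V p + (d$2 * (b0 V p * p$1) + (d$3 * (b0 V p * p$2) + (d$4 * (b0 V p * l13 V p * l24 V p) + 0))))"
  have "p \<in> poly_space 3" unfolding p_def by (rule cubic_in_poly_space)
  moreover have "s \<in> funs.span {phi1 V, phi2 V}"
    unfolding s_def span_insert_funs funs.span_empty zero_fun_def by blast
  moreover have "v \<in> W_bubble V"
    unfolding v_def W_bubble_def span_insert_funs funs.span_empty zero_fun_def by blast
  moreover have "shape_fun V x = (p + s) + v"
    by (simp add: x p_def s_def v_def shape_fun_def fun_eq_iff algebra_simps)
  ultimately show "\<exists>u v. shape_fun V x = u + v \<and> u \<in> W_minus V \<and> v \<in> W_bubble V"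
    unfolding W_minus_def by blast
qed

lemma W_space_eq: "W_space V n = {w \<in> range (shape_fun V). \<forall>i. normal_defect V n i w = 0}"
  unfolding W_space_def W_sum_eq_range normal_defect_def by auto

lemma tau_simps:
  "tau V 1 w = w (V 1)" "tau V 2 w = w (V 2)" "tau V 3 w = w (V 3)" "tau V 4 w = w (V 4)"
  "tau V 5 w = dir_deriv (axis 1 1) w (V 1)" "tau V 6 w = dir_deriv (axis 1 1) w (V 2)"
  "tau V 7 w = dir_deriv (axis 1 1) w (V 3)" "tau V 8 w = dir_deriv (axis 1 1) w (V 4)"
  "tau V 9 w = dir_deriv (axis 2 1) w (V 1)" "tau V 10 w = dir_deriv (axis 2 1) w (V 2)"
  "tau V 11 w = dir_deriv (axis 2 1) w (V 3)" "tau V 12 w = dir_deriv (axis 2 1) w (V 4)"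
  by (simp_all add: tau_def gradient_def)

lemma ball_1_12: "(\<forall>j\<in>{1..12::nat}. P j) \<longleftrightarrow>
    P 1 \<and> P 2 \<and> P 3 \<and> P 4 \<and> P 5 \<and> P 6 \<and> P 7 \<and> P 8 \<and> P 9 \<and> P 10 \<and> P 11 \<and> P 12"
proof -
  have "{1..12::nat} = {1,2,3,4,5,6,7,8,9,10,11,12}"
    by (simp add: eval_nat_numeral atLeastAtMostSuc_conv insert_commute)
  then show ?thesis by simp
qed

lemma tau_add:
  assumes "real_polynomial_function f" "real_polynomial_function g"
  shows "tau V j (f + g) = tau V j f + tau V j g"
  unfolding tau_def gradient_def plus_fun_def
  using assms by (simp add: dir_deriv_add real_polynomial_function_differentiable)

lemma tau_scale:
  assumes "real_polynomial_function f"
  shows "tau V j (scale_fun c f) = c * tau V j f"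
  unfolding tau_def gradient_def scale_fun_def
  using assms by (simp add: dir_deriv_scale real_polynomial_function_differentiable)

section \<open>Degrees of freedom and dimension of \<open>W_space\<close>\<close>

locale convex_quad_normals = convex_quad +
  fixes n :: "4 \<Rightarrow> real^2"
  assumes normals: "\<And>i. edge_unit_normal V i (n i)"
begin

lemma m_affine: "\<exists>u k. m13 V = (\<lambda>p. u \<bullet> p + k)" "\<exists>u k. m24 V = (\<lambda>p. u \<bullet> p + k)"
  unfolding m13_def m24_def edge_mid_ref using jac_pos
  by (auto intro!: line_function_affine simp: cross2_ref)

lemma shape_fun_polynomial: "real_polynomial_function (shape_fun V x)"
proof -
  obtain a b c d where x: "x = (a, b, c, d)" by (rule prod_cases4)
  note affine = affine_polynomial[OF m_affine(1)] affine_polynomial[OF m_affine(2)]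
    affine_polynomial[OF l_edge_affine] affine_polynomial[OF diagonal_affine(1)] affine_polynomial[OF diagonal_affine(2)]
  have "real_polynomial_function (phi1 V)" "real_polynomial_function (phi2 V)"
    unfolding phi_factored[abs_def]
    by (intro real_polynomial_function.intros(2-4) real_polynomial_function_diff affine)+
  moreover have "real_polynomial_function (b0 V)"
    unfolding b0_def by (intro real_polynomial_function.intros(4) affine)
  ultimately show ?thesis
    unfolding x shape_fun_def prod.case
    by (intro real_polynomial_function.intros(2-4) poly_space_polynomial[OF cubic_in_poly_space]
        affine real_polynomial_function_nth)
qed

text \<open>Concluding about the coefficients, not just the function, includes the independence of
  the sixteen generators.\<close>

lemma shape_fun_unisolvent:
  assumes "\<And>i. shape_fun V x (V i) = 0"
    and "\<And>i. dir_deriv (axis 1 1) (shape_fun V x) (V i) = 0" "\<And>i. dir_deriv (axis 2 1) (shape_fun V x) (V i) = 0"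
    and defect: "\<And>i. normal_defect V n i (shape_fun V x) = 0"
  shows "x = 0"
proof -
  obtain a b c d where x: "x = (a, b, c, d)" by (rule prod_cases4)
  define p where "p = (\<lambda>z::real^2. cubic (a$1) (a$2) (a$3) (a$4) (b$1) (b$2) (b$3) (b$4) (c$1) (c$2) (z$1) (z$2))"
  define q where "q = (\<lambda>z. d$1 + d$2 * z$1 + d$3 * z$2 + d$4 * l13 V z * l24 V z)"
  have w: "shape_fun V x = (\<lambda>z. p z + c$3 * phi1 V z + c$4 * phi2 V z + b0 V z * q z)"
    by (simp add: x shape_fun_def p_def q_def)
  have grad: "dir_deriv v (shape_fun V x) (V i) = 0" for v i
    by (subst dir_deriv_axis[OF real_polynomial_function_differentiable[OF shape_fun_polynomial]])
      (simp add: assms(2,3))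
  have "p \<in> poly_space 3" unfolding p_def by (rule cubic_in_poly_space)
  note z = zero_dofs_imp_bubble[OF this w shape_fun_polynomial assms(1) grad]
  have "cubic (a$1) (a$2) (a$3) (a$4) (b$1) (b$2) (b$3) (b$4) (c$1) (c$2) x y = 0" for x y
    using fun_cong[OF z(1), of "vector [x, y]"] by (simp add: p_def)
  note c = cubic_eq_0D[OF this]
  have "shape_fun V x = (\<lambda>z. b0 V z * (d$1 + d$2 * z$1 + d$3 * z$2 + d$4 * l13 V z * l24 V z))"
    unfolding w z q_def by simp
  \<comment> \<open>The gradients vanish at the vertices, so the constraint reduces to a vanishing
    integral.\<close>
  moreover have "edge_integral V i (dir_deriv (n i) (shape_fun V x)) = 0" for i
    using defect[of i] vertex_distinct[of i] by (simp add: normal_defect_def grad edge_length_def)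
  ultimately have "d$1 = 0 \<and> d$2 = 0 \<and> d$3 = 0 \<and> d$4 = 0"
    by (rule bubble_zero[OF normals])
  then show ?thesis using c z by (simp add: x zero_prod_def vec_eq_iff forall_4)
qed

text \<open>The sixteen conditions define an injective linear endomorphism \<open>L\<close> of the
  coefficient space, which is therefore onto.\<close>

lemma dofs_surjective: "\<exists>w \<in> W_space V n. \<forall>j \<in> {1..12}. tau V j w = g j"
proof -
  define L :: "coeffs \<Rightarrow> coeffs" where "L x = (\<chi> i. shape_fun V x (V i), \<chi> i. dir_deriv (axis 1 1) (shape_fun V x) (V i),
     \<chi> i. dir_deriv (axis 2 1) (shape_fun V x) (V i), \<chi> i. normal_defect V n i (shape_fun V x))" for x
  note polys = shape_fun_polynomial real_polynomial_function_differentiable[OF shape_fun_polynomial]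
  have "linear L"
    by (rule linearI)
      (simp_all add: L_def vec_eq_iff shape_fun_add shape_fun_scale dir_deriv_add dir_deriv_scale
        normal_defect_add normal_defect_scale polys)
  moreover have "x = 0" if "L x = 0" for x
    using that by (intro shape_fun_unisolvent) (simp_all add: L_def zero_prod_def vec_eq_iff)
  ultimately have "surj L"
    using linear_injective_0[of L] linear_injective_imp_surjective[of L] by blast
  \<comment> \<open>The last block prescribes zero defects, which places the preimage in
    \<open>W_space\<close>.\<close>
  define y :: coeffs where "y = (\<chi> i. if i = 1 then g 1 else if i = 2 then g 2 else if i = 3 then g 3 else g 4,
      \<chi> i. if i = 1 then g 5 else if i = 2 then g 6 else if i = 3 then g 7 else g 8,
      \<chi> i. if i = 1 then g 9 else if i = 2 then g 10 else if i = 3 then g 11 else g 12, 0)"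
  obtain x where "L x = y" using \<open>surj L\<close> by (metis surj_def)
  note x = this[unfolded L_def y_def]
  have "shape_fun V x \<in> W_space V n"
    using x by (simp add: W_space_eq vec_eq_iff)
  moreover have "\<forall>j \<in> {1..12}. tau V j (shape_fun V x) = g j"
    using x unfolding ball_1_12 tau_simps by (simp add: vec_eq_iff forall_4)
  ultimately show ?thesis by blast
qed

lemma W_space_polynomial: "w \<in> W_space V n \<Longrightarrow> real_polynomial_function w"
  by (auto simp: W_space_eq shape_fun_polynomial)

lemma dofs_injective:
  assumes "w \<in> W_space V n" "\<forall>j \<in> {1..12}. tau V j w = 0"
  shows "w = 0"
proof -
  obtain x where w: "w = shape_fun V x" and d: "\<And>i. normal_defect V n i (shape_fun V x) = 0"
    using assms(1) by (auto simp: W_space_eq)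
  have "w (V i) = 0 \<and> dir_deriv (axis 1 1) w (V i) = 0 \<and> dir_deriv (axis 2 1) w (V i) = 0" for i
    using assms(2) exhaust_4[of i] unfolding ball_1_12 tau_simps by (elim disjE) simp_all
  then have "x = 0" using d unfolding w by (intro shape_fun_unisolvent) simp_all
  then have "w = shape_fun V (0 *\<^sub>R x)" by (simp add: w)
  then show ?thesis by (simp only: shape_fun_scale) (simp add: fun_eq_iff)
qed

lemma W_space_subspace: "funs.subspace (W_space V n)"
  unfolding funs.subspace_def
proof (intro conjI ballI allI)
  have "shape_fun V (0 *\<^sub>R 0) = 0" by (simp only: shape_fun_scale) (simp add: fun_eq_iff)
  then have "0 = shape_fun V 0" by simp
  then have "0 \<in> range (shape_fun V)" by (rule range_eqI)
  moreover have "normal_defect V n i 0 = 0" for i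
    using normal_defect_poly_space_2[of "\<lambda>p. 0" V i n, OF poly_space_const vertex_distinct] by (simp add: zero_fun_def)
  ultimately show "0 \<in> W_space V n" unfolding W_space_eq by simp
next
  fix f g assume "f \<in> W_space V n" "g \<in> W_space V n"
  then obtain x y where f: "f = shape_fun V x" "\<And>i. normal_defect V n i f = 0"
    and g: "g = shape_fun V y" "\<And>i. normal_defect V n i g = 0" by (auto simp: W_space_eq)
  have "f + g = shape_fun V (x + y)" by (simp add: shape_fun_add f g fun_eq_iff)
  moreover have "normal_defect V n i (f + g) = 0" for i
    using normal_defect_add[of f g V n i] f g shape_fun_polynomial by (simp add: plus_fun_def)
  ultimately show "f + g \<in> W_space V n" by (simp add: W_space_eq)
next
  fix c f assume "f \<in> W_space V n"
  then obtain x where f: "f = shape_fun V x" "\<And>i. normal_defect V n i f = 0" by (auto simp: W_space_eq)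
  have "scale_fun c f = shape_fun V (c *\<^sub>R x)" by (simp add: shape_fun_scale f scale_fun_def)
  moreover have "normal_defect V n i (scale_fun c f) = 0" for i
    using normal_defect_scale[of f V n i c] f shape_fun_polynomial by (simp add: scale_fun_def)
  ultimately show "scale_fun c f \<in> W_space V n" by (simp add: W_space_eq)
qed

lemma dim_W_space: "funs.dim (W_space V n) = 12"
proof -
  have "funs.dim (W_space V n) = card {1..12::nat}"
    by (rule funs.dim_eq_card_functionals[where T = "tau V", OF W_space_subspace])
      (use dofs_injective dofs_surjective in \<open>auto simp: tau_add tau_scale W_space_polynomial\<close>)
  then show ?thesis by simp
qed

lemma quintic_on_edge_W_space:
  assumes "w \<in> W_space V n"
  shows "quintic_on_edge V i w"
proof -
  obtain x where "w = shape_fun V x" using assms by (auto simp: W_space_eq)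
  moreover obtain a b c d where "x = (a, b, c, d)" by (rule prod_cases4)
  ultimately have w: "w = shape_fun V (a, b, c, d)" by simp
  show ?thesis
    unfolding w shape_fun_def prod.case by (rule quintic_on_edge_shape[OF cubic_in_poly_space])
qed

lemma poly_space_2_subset_W_space: "poly_space 2 \<subseteq> W_space V n"
proof
  fix f assume f: "f \<in> poly_space 2"
  then have "f \<in> poly_space 3" using poly_space_mono[of 2 3] by auto
  moreover have "0 \<in> funs.span {phi1 V, phi2 V}" by (rule funs.span_zero)
  moreover have "f = f + 0" by simp
  ultimately have "f \<in> W_minus V" unfolding W_minus_def by blast
  moreover have "0 \<in> W_bubble V" unfolding W_bubble_def by (rule funs.span_zero)
  ultimately have "f \<in> {u + v |u v. u \<in> W_minus V \<and> v \<in> W_bubble V}"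
    using \<open>f = f + 0\<close> by blast
  then show "f \<in> W_space V n"
    unfolding W_sum_eq_range W_space_eq
    using normal_defect_poly_space_2[of f V _ n, OF f vertex_distinct] by simp
qed

end

theorem theorem2p8:
  fixes K :: "(real^2) set" and V n :: "4 \<Rightarrow> real^2"
  assumes "convex_quadrilateral K V"
    and "\<And>i. edge_unit_normal V i (n i)"
  shows "(funs.dim (W_space V n) = 12 \<and>
          (\<forall>w \<in> W_space V n. (\<forall>j \<in> {1..12}. tau V j w = 0) \<longrightarrow> w = 0)) \<and>
         (\<forall>w \<in> W_space V n. \<forall>i.
            1 / edge_length V i * edge_integral V i w
            = 1/2 * (w (V i) + w (V (i + 1)))
              - edge_length V i / 12 * (dir_deriv (edge_tangent V i) w (V (i + 1))
                                        - dir_deriv (edge_tangent V i) w (V i))) \<and>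
         poly_space 2 \<subseteq> W_space V n"
proof -
  interpret convex_quad_normals V n
    using assms by unfold_locales (auto simp: convex_quadrilateral_def)
  show ?thesis
    by (intro conjI ballI allI impI dim_W_space dofs_injective poly_space_2_subset_W_space
        corrected_trapezoidal quintic_on_edge_W_space W_space_polynomial vertex_distinct) blast+
qed

end
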